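(* Let $\sigma_1,\sigma_2>0$, $\eta\in[1/2,1]$, and let $\xi_1\ne\xi_2$ with $\max\{\xi_1,\xi_2\}<0$. Let $(X_1,X_2)$ be a random vector with positive components and a joint density, with margins $X_i\sim\mathrm{GPD}(\sigma_i,\xi_i)$, $i=1,2$. Suppose that $(X_1,X_2)$ satisfies the joint tail model (LT) with coefficient $\eta$ and twice differentiable function $g$, with equality for large $x_1+x_2$, as described in the context. Let $R=X_1+X_2$, $r^F=-(\sigma_1/\xi_1+\sigma_2/\xi_2)$, $\xi_{max}=\max\{\xi_1,\xi_2\}$, $\xi_{min}=\min\{\xi_1,\xi_2\}$, and let $\sigma_{M}$ and $\sigma_{m}$ denote the scale parameters $\sigma_i$ of the components with $\xi_i=\xi_{max}$ and $\xi_i=\xi_{min}$ respectively. Then, as $r\to r^F$: (i) if Condition 2 of the context holds, $$\Pr\{R\ge r\}\sim K_{(2)}\left(1+\frac{\xi_1\xi_2r}{\sigma_1\xi_2+\sigma_2\xi_1}\right)^{-\frac1{\xi_{max}}\left(\frac1{2\eta}+\kappa\right)-\frac1{\xi_{min}}\left(\frac1{2\eta}-\kappa\right)},$$ where, with $A=\frac1{2\eta}+\kappa$, $B_0=\frac1{2\eta}-\kappa$, $p=-A/\xi_{max}-B_0/\xi_{min}$ and $B(\cdot,\cdot)$ the beta function, $$K_{(2)}=\frac{K_g}{p}\Big(\frac1{4\eta^2}-\kappa^2\Big)(-\xi_{max})^{-\frac{A}{\xi_{max}}-1}(-\xi_{min})^{-\frac{B_0}{\xi_{min}}-1}\sigma_M^{A/\xi_{max}}\sigma_m^{B_0/\xi_{min}}(r^F)^{p}\,B\Big(-\frac{A}{\xi_{max}},-\frac{B_0}{\xi_{min}}\Big)>0;$$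 (ii) if Condition 3b of the context holds, $$\Pr\{R\ge r\}\sim K_{(3b)}\left(1+\frac{\xi_1\xi_2r}{\sigma_1\xi_2+\sigma_2\xi_1}\right)^{-\frac1{\xi_{max}}},$$ where $$K_{(3b)}=\begin{cases}|H_1(1,\infty)|\,(-\xi_1)^{-1/\xi_1}(r^F)^{-1/\xi_1}\sigma_1^{1/\xi_1}>0,&\text{if }\xi_{max}=\xi_1,\\ |H_2(\infty,1)|\,(-\xi_2)^{-1/\xi_2}(r^F)^{-1/\xi_2}\sigma_2^{1/\xi_2}>0,&\text{if }\xi_{max}=\xi_2,\end{cases}$$ with $H_1(1,\infty)=\lim_{z\to\infty}H_1(1,z)$ and $H_2(\infty,1)=\lim_{z\to\infty}H_2(z,1)$.
   Context: Notation: $f(x)\sim h(x)$ as $x\to a$ means $f(x)/h(x)\to1$. $\mathrm{GPD}(\sigma,\xi)$ with $\sigma>0$, $\xi<0$ is the generalised Pareto distribution on $x>0$ with distribution function $1-(1+\xi x/\sigma)_+^{-1/\xi}$, where $z_+=\max\{0,z\}$. $F_i$ is the distribution function of $X_i$, and $x_i^F=-\sigma_i/\xi_i$ its upper endpoint. Joint tail model (LT). There are $\eta\in[1/2,1]$, a positive slowly varying function $\mathcal L$ and a continuous $g:(0,1)\to\mathbb{R}_+$, with existing first and second derivatives, such that $$\Pr\{F_1(X_1)>1-1/y_1,\,F_2(X_2)>1-1/y_2\}\sim\mathcal L(y_1+y_2)(y_1y_2)^{-\frac1{2\eta}}g\big(y_1/(y_1+y_2)\big)$$ for any $y_1\to\infty$,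 $y_2\to\infty$ with $y_1/(y_1+y_2)\to w\in(0,1)$. There is a fixed $v>0$ such that $\mathcal L(y)$ is a positive constant for $y>v$, and this constant is absorbed into $g$ (i.e. $\mathcal L(y)=1$ for $y>v$). Moreover the relation holds with equality in the tail of the sum: writing $y_i=1/(1-F_i(x_i))$, $$\Pr\{X_1>x_1,X_2>x_2\}=\mathcal L(y_1+y_2)(y_1y_2)^{-\frac1{2\eta}}g\big(y_1/(y_1+y_2)\big)$$ whenever $0<x_i<x_i^F$ ($i=1,2$) and $x_1+x_2\ge\max\{c,u^*\}$, for some fixed constant $c$ with $0<c<r^F$, where $u^*=\max\{-\sigma_1/\xi_1,-\sigma_2/\xi_2\}$. Condition 2. $g(w)\sim K_gw^{\kappa}$ as $w\to0$ and $g(w)\sim K_g(1-w)^\kappa$ as $w\to1$, for a constant $K_g>0$ and a fixed $0\le\kappa<1/(2\eta)$. Condition 3. $\eta=1$ and, as $w\to0$ or $w\to1$, $g(w)\sim w^{-1/2}(1-w)^{-1/2}[1-H((1-w)^{-1},w^{-1})]$, where the bivariate function $H$ is homogeneous of order $-1$, its first-order partial derivatives $H_1,H_2$ (with respect to the first and second argument) and second-order mixed partial derivative $H_{12}$ exist and are continuous, and $\lim_{z\to\infty}H(z,t)=\lim_{z\to\infty}H(t,z)=t^{-1}$ for $t>0$. Condition 3b. Condition 3 holds and, in addition: if $\xi_1>\xi_2$, then $\lim_{z\to\infty}H_1(1,z)<\infty$ and $\lim_{z\to0}H_1(1,z)=0$; if $\xi_1<\xi_2$, then $\lim_{z\to\infty}H_2(z,1)<\infty$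 and $\lim_{z\to0}H_2(z,1)=0$. *)

theory Defs
  imports "HOL-Probability.Probability" "HOL-Library.Landau_Symbols"
begin

text \<open>Generalised Pareto distribution function, for shape parameter \<^term>\<open>\<xi> < 0\<close>. Beyond the upper
  endpoint \<^term>\<open>- \<sigma> / \<xi>\<close> the base of the power is 0, and \<^term>\<open>0 powr a = 0\<close> gives the value 1.\<close>

definition gpd_cdf :: "real \<Rightarrow> real \<Rightarrow> real \<Rightarrow> real" where
  "gpd_cdf \<sigma> \<xi> x = (if x \<le> 0 then 0 else 1 - (max 0 (1 + \<xi> * x / \<sigma>)) powr (- 1 / \<xi>))"

definition slowly_varying :: "(real \<Rightarrow> real) \<Rightarrow> bool" where
  "slowly_varying L \<longleftrightarrow> (\<forall>t>0. ((\<lambda>y. L (t * y) / L y) \<longlongrightarrow> 1) at_top)"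

text \<open>The common right-hand side of the asymptotic and of the exact joint tail relation.\<close>

definition joint_tail_form :: "(real \<Rightarrow> real) \<Rightarrow> real \<Rightarrow> (real \<Rightarrow> real) \<Rightarrow> real \<Rightarrow> real \<Rightarrow> real" where
  "joint_tail_form L \<eta> g y1 y2 =
     L (y1 + y2) * (y1 * y2) powr (- 1 / (2 * \<eta>)) * g (y1 / (y1 + y2))"

text \<open>Joint tail model for \<^term>\<open>(X1, X2)\<close> with GPD margins. A limit along all \<^term>\<open>y1\<close>, \<^term>\<open>y2\<close> tending
  to infinity with \<^term>\<open>y1 / (y1 + y2)\<close> tending to \<^term>\<open>w\<close> is expressed through all sequences of
  this kind. The functions \<^term>\<open>g\<close> and \<^term>\<open>L\<close> matter only on the open unit interval and on the
  positive reals, respectively.\<close>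

definition joint_tail_model ::
  "'a measure \<Rightarrow> ('a \<Rightarrow> real) \<Rightarrow> ('a \<Rightarrow> real) \<Rightarrow> real \<Rightarrow> real \<Rightarrow> real \<Rightarrow> real \<Rightarrow> real \<Rightarrow> (real \<Rightarrow> real) \<Rightarrow> bool"
where
  "joint_tail_model M X1 X2 \<sigma>1 \<xi>1 \<sigma>2 \<xi>2 \<eta> g \<longleftrightarrow>
     (let F1 = cdf (distr M borel X1);
          F2 = cdf (distr M borel X2);
          u = max (- \<sigma>1 / \<xi>1) (- \<sigma>2 / \<xi>2);
          rF = - (\<sigma>1 / \<xi>1 + \<sigma>2 / \<xi>2)
      in 1 / 2 \<le> \<eta> \<and> \<eta> \<le> 1 \<and>
         (\<forall>w\<in>{0<..<1}. g w \<ge> 0) \<and>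
         continuous_on {0<..<1} g \<and>
         g differentiable_on {0<..<1} \<and>
         deriv g differentiable_on {0<..<1} \<and>
         (\<exists>L. (\<forall>y>0. L y > 0) \<and> slowly_varying L \<and>
              (\<exists>v>0. \<forall>y>v. L y = 1) \<and>
              (\<forall>w\<in>{0<..<1}. \<forall>y1 y2 :: nat \<Rightarrow> real.
                 filterlim y1 at_top sequentially \<longrightarrow>
                 filterlim y2 at_top sequentially \<longrightarrow>
                 (\<lambda>n. y1 n / (y1 n + y2 n)) \<longlonglongrightarrow> w \<longrightarrow>
                 (\<lambda>n. measure M {\<omega> \<in> space M. F1 (X1 \<omega>) > 1 - 1 / y1 n \<and> F2 (X2 \<omega>) > 1 - 1 / y2 n})
                   \<sim>[sequentially] (\<lambda>n. joint_tail_form L \<eta> g (y1 n) (y2 n))) \<and>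
              (\<exists>c. 0 < c \<and> c < rF \<and>
                 (\<forall>x1 x2. 0 < x1 \<longrightarrow> x1 < - \<sigma>1 / \<xi>1 \<longrightarrow> 0 < x2 \<longrightarrow> x2 < - \<sigma>2 / \<xi>2 \<longrightarrow>
                    x1 + x2 \<ge> max c u \<longrightarrow>
                    measure M {\<omega> \<in> space M. X1 \<omega> > x1 \<and> X2 \<omega> > x2} =
                      joint_tail_form L \<eta> g (1 / (1 - F1 x1)) (1 / (1 - F2 x2))))))"

definition condition2 :: "real \<Rightarrow> (real \<Rightarrow> real) \<Rightarrow> real \<Rightarrow> real \<Rightarrow> bool" where
  "condition2 \<eta> g Kg \<kappa> \<longleftrightarrow>
     Kg > 0 \<and> 0 \<le> \<kappa> \<and> \<kappa> < 1 / (2 * \<eta>) \<and>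
     g \<sim>[at_right 0] (\<lambda>w. Kg * w powr \<kappa>) \<and>
     g \<sim>[at_left 1] (\<lambda>w. Kg * (1 - w) powr \<kappa>)"

definition partial1 :: "(real \<Rightarrow> real \<Rightarrow> real) \<Rightarrow> real \<Rightarrow> real \<Rightarrow> real" where
  "partial1 H x y = deriv (\<lambda>s. H s y) x"

definition partial2 :: "(real \<Rightarrow> real \<Rightarrow> real) \<Rightarrow> real \<Rightarrow> real \<Rightarrow> real" where
  "partial2 H x y = deriv (\<lambda>s. H x s) y"

text \<open>All requirements on \<^term>\<open>H\<close> are on the open positive quadrant. \<^term>\<open>partial2 (partial1 H)\<close> is
  the mixed derivative, taken first in the first and then in the second argument.\<close>

definition condition3 :: "real \<Rightarrow> (real \<Rightarrow> real) \<Rightarrow> (real \<Rightarrow> real \<Rightarrow> real) \<Rightarrow> bool" where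
  "condition3 \<eta> g H \<longleftrightarrow>
     \<eta> = 1 \<and>
     (\<forall>F\<in>{at_right 0, at_left 1}.
        g \<sim>[F] (\<lambda>w. w powr (- 1 / 2) * (1 - w) powr (- 1 / 2) * (1 - H (1 / (1 - w)) (1 / w)))) \<and>
     (\<forall>k>0. \<forall>x>0. \<forall>y>0. H (k * x) (k * y) = H x y / k) \<and>
     (\<forall>x>0. \<forall>y>0. (\<lambda>s. H s y) differentiable (at x) \<and> (\<lambda>s. H x s) differentiable (at y) \<and>
                     (\<lambda>s. partial1 H x s) differentiable (at y)) \<and>
     continuous_on ({0<..} \<times> {0<..}) (\<lambda>(x, y). partial1 H x y) \<and>
     continuous_on ({0<..} \<times> {0<..}) (\<lambda>(x, y). partial2 H x y) \<and>
     continuous_on ({0<..} \<times> {0<..}) (\<lambda>(x, y). partial2 (partial1 H) x y) \<and>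
     (\<forall>t>0. ((\<lambda>z. H z t) \<longlongrightarrow> 1 / t) at_top \<and> ((\<lambda>z. H t z) \<longlongrightarrow> 1 / t) at_top)"

definition condition3b ::
  "real \<Rightarrow> (real \<Rightarrow> real) \<Rightarrow> (real \<Rightarrow> real \<Rightarrow> real) \<Rightarrow> real \<Rightarrow> real \<Rightarrow> bool" where
  "condition3b \<eta> g H \<xi>1 \<xi>2 \<longleftrightarrow>
     condition3 \<eta> g H \<and>
     (\<xi>1 > \<xi>2 \<longrightarrow> (\<exists>l. ((\<lambda>z. partial1 H 1 z) \<longlongrightarrow> l) at_top) \<and>
                   ((\<lambda>z. partial1 H 1 z) \<longlongrightarrow> 0) (at_right 0)) \<and>
     (\<xi>1 < \<xi>2 \<longrightarrow> (\<exists>l. ((\<lambda>z. partial2 H z 1) \<longlongrightarrow> l) at_top) \<and>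
                   ((\<lambda>z. partial2 H z 1) \<longlongrightarrow> 0) (at_right 0))"

definition K2 :: "real \<Rightarrow> real \<Rightarrow> real \<Rightarrow> real \<Rightarrow> real \<Rightarrow> real \<Rightarrow> real \<Rightarrow> real \<Rightarrow> real" where
  "K2 Kg \<eta> \<kappa> \<xi>max \<xi>min \<sigma>M \<sigma>m rF =
     (let A = 1 / (2 * \<eta>) + \<kappa>;
          B0 = 1 / (2 * \<eta>) - \<kappa>;
          p = - A / \<xi>max - B0 / \<xi>min
      in Kg / p * (1 / (4 * \<eta>\<^sup>2) - \<kappa>\<^sup>2) *
         (- \<xi>max) powr (- A / \<xi>max - 1) * (- \<xi>min) powr (- B0 / \<xi>min - 1) *
         \<sigma>M powr (A / \<xi>max) * \<sigma>m powr (B0 / \<xi>min) * rF powr p *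
         Beta (- A / \<xi>max) (- B0 / \<xi>min))"

definition K3b :: "(real \<Rightarrow> real \<Rightarrow> real) \<Rightarrow> real \<Rightarrow> real \<Rightarrow> real \<Rightarrow> real \<Rightarrow> real \<Rightarrow> real" where
  "K3b H \<sigma>1 \<xi>1 \<sigma>2 \<xi>2 rF =
     (if max \<xi>1 \<xi>2 = \<xi>1
      then \<bar>Lim at_top (\<lambda>z. partial1 H 1 z)\<bar> *
           (- \<xi>1) powr (- 1 / \<xi>1) * rF powr (- 1 / \<xi>1) * \<sigma>1 powr (1 / \<xi>1)
      else \<bar>Lim at_top (\<lambda>z. partial2 H z 1)\<bar> *
           (- \<xi>2) powr (- 1 / \<xi>2) * rF powr (- 1 / \<xi>2) * \<sigma>2 powr (1 / \<xi>2))"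

end

theory Submission
  imports Defs
begin

text \<open>With \<open>Si = ui - Xi\<close>, where \<open>ui = - \<sigma>i / \<xi>i\<close>, the event \<open>R \<ge> r\<close> becomes
  \<open>S1 + S2 \<le> e\<close> with \<open>e = rF - r\<close>, and the tail model describes \<open>prob (S1 < e * x, S2 < e * y)\<close> exactly
  for small \<open>e\<close>. If \<open>\<xi>2 < \<xi>1\<close> and \<open>g w \<sim> K * (1 - w) powr \<kappa>\<close> at 1, these probabilities are asymptotic to
  \<open>C * e powr (a + b) * x powr a * y powr b\<close>, where \<open>b > 0\<close> under Condition 2. Covering the simplex
  \<open>S1 + S2 \<le> e\<close> by thin strips then gives a Beta integral in the limit.
  Condition 3b amounts to \<open>g w \<sim> sqrt (1 - w)\<close>, hence \<open>b = 0\<close>: the limit measure lives on the axis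
  \<open>y = 0\<close>, the sum has the same tail as \<open>X1\<close>, and \<open>H1(1,\<infinity>)\<close> is forced to be \<open>-1\<close>.
  The case \<open>\<xi>1 < \<xi>2\<close> is symmetric, with \<open>g (1 - w)\<close> and \<open>H y x\<close>.\<close>

section \<open>Riemann sums for a Beta integral\<close>

lemma powr_weight_has_integral:
  fixes a s t :: real
  assumes "a > 0" "0 \<le> s" "s \<le> t"
  shows "((\<lambda>x. a * x powr (a - 1)) has_integral (t powr a - s powr a)) {s..t}"
proof (rule fundamental_theorem_of_calculus_interior)
  show "continuous_on {s..t} (\<lambda>x. x powr a)"
    using assms by (intro continuous_on_powr' continuous_intros) auto
  show "((\<lambda>x. x powr a) has_vector_derivative a * x powr (a - 1)) (at x)" if "x \<in> {s<..<t}" for x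
    using that assms
    by (auto simp: has_real_derivative_iff_has_vector_derivative[symmetric] intro!: has_real_derivative_powr)
qed (use assms in auto)

text \<open>If every rectangle \<open>[0, x] \<times> [0, y]\<close> has mass
  \<open>x powr a * y powr b\<close>, then the simplex below \<open>x + y = 1\<close> has the mass
  found by integrating the height term \<open>(1 - x) powr b\<close> against the differential of
  \<open>x powr a\<close>. This is the source of the limiting constant.\<close>

lemma powr_Beta_has_integral:
  fixes a b :: real
  assumes "a > 0" "b > 0"
  shows "((\<lambda>x. a * x powr (a - 1) * (1 - x) powr b) has_integral a * Beta a (b + 1)) {0..1}"
proof -
  have "((\<lambda>x. x powr (a - 1) * (1 - x) powr (b + 1 - 1)) has_integral Beta a (b + 1)) {0..1}"
    using assms by (intro has_integral_Beta_real) auto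
  from has_integral_mult_right[OF this, of a] show ?thesis
    by (simp add: mult.assoc)
qed

text \<open>On \<open>{s..t}\<close> the factor \<open>(1 - x) powr b\<close> decreases, so it lies
  between its values at the endpoints; the remaining weight integrates exactly to
  \<open>t powr a - s powr a\<close>.\<close>

lemma powr_Beta_integral_sandwich:
  fixes a b s t :: real
  assumes "a > 0" "b > 0" "0 \<le> s" "s \<le> t" "t \<le> 1"
  defines "f \<equiv> \<lambda>x. a * x powr (a - 1) * (1 - x) powr b"
  shows "(t powr a - s powr a) * (1 - t) powr b \<le> integral {s..t} f"
    and "integral {s..t} f \<le> (t powr a - s powr a) * (1 - s) powr b"
proof -
  have "f integrable_on {0..1}"
    using powr_Beta_has_integral[OF assms(1,2)] unfolding f_def by blast
  then have f: "(f has_integral integral {s..t} f) {s..t}"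
    using assms by (intro integrable_integral) (rule integrable_on_subinterval[of f "{0..1}"], auto)
  have c: "((\<lambda>x. a * x powr (a - 1) * c) has_integral (t powr a - s powr a) * c) {s..t}" for c
    using has_integral_mult_left[OF powr_weight_has_integral[of a s t]] assms by auto
  show "(t powr a - s powr a) * (1 - t) powr b \<le> integral {s..t} f"
    by (rule has_integral_le[OF c f]) (use assms in \<open>auto simp: f_def intro!: mult_left_mono powr_mono2\<close>)
  show "integral {s..t} f \<le> (t powr a - s powr a) * (1 - s) powr b"
    by (rule has_integral_le[OF f c]) (use assms in \<open>auto simp: f_def intro!: mult_left_mono powr_mono2\<close>)
qed

text \<open>The mesh \<open>1 / n\<close> stays fixed while the number \<open>m\<close> of strips
  grows, which allows an induction that adds one strip at a time.\<close>

lemma powr_Beta_Riemann_sandwich: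
  fixes a b :: real
  assumes "a > 0" "b > 0" "n > 0" "m \<le> n"
  defines "f \<equiv> \<lambda>x. a * x powr (a - 1) * (1 - x) powr b"
    and "x \<equiv> \<lambda>k. real k / real n"
  shows "(\<Sum>k<m. (x (Suc k) powr a - x k powr a) * (1 - x (Suc k)) powr b) \<le> integral {0..x m} f \<and>
         integral {0..x m} f \<le> (\<Sum>k<m. (x (Suc k) powr a - x k powr a) * (1 - x k) powr b)"
  using \<open>m \<le> n\<close>
proof (induction m)
  case 0
  then show ?case by (simp add: x_def)
next
  case (Suc m)
  have x: "0 \<le> x m" "x m \<le> x (Suc m)" "x (Suc m) \<le> 1"
    using Suc.prems assms by (auto simp: x_def divide_simps)
  have "f integrable_on {0..1}"
    using powr_Beta_has_integral[OF assms(1,2)] unfolding f_def by blast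
  then have "f integrable_on {0..x (Suc m)}"
    using x by - (rule integrable_on_subinterval[of f "{0..1}"], auto)
  then have "integral {0..x (Suc m)} f = integral {0..x m} f + integral {x m..x (Suc m)} f"
    using x by (intro Henstock_Kurzweil_Integration.integral_combine[symmetric]) auto
  with Suc.IH Suc.prems powr_Beta_integral_sandwich[OF assms(1,2) x, folded f_def] show ?case
    by auto
qed

text \<open>The two sums have the shape of the strip bounds for the simplex: the upper one has a
  further strip \<open>k = n\<close> and heights raised by \<open>1 / n\<close>. Corresponding
  heights differ by \<open>2 / n\<close> in the argument of a uniformly continuous function, so the
  sums come close to each other, with the integral between them.\<close>

lemma powr_Beta_Riemann_sums:
  fixes a b \<delta> :: real
  assumes "a > 0" "b > 0" "\<delta> > 0"
  obtains n :: nat where "n > 0"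
    "a * Beta a (b + 1) - \<delta> < (\<Sum>k<n. ((real (Suc k) / n) powr a - (k / n) powr a) * (1 - real (Suc k) / n) powr b)"
    "(\<Sum>k\<le>n. ((real (Suc k) / n) powr a - (k / n) powr a) * (1 - k / n + 1 / n) powr b) < a * Beta a (b + 1) + \<delta>"
proof -
  \<comment> \<open>Truncation at 0 makes the height function continuous on the whole line, as
    \<open>b > 0\<close>; the argument is negative in the last term, \<open>k = n\<close>, of
    \<open>L\<close> below. All arguments lie in \<open>{-1..2}\<close>.\<close>
  define \<phi> where "\<phi> = (\<lambda>y::real. (max 0 y) powr b)"
  \<comment> \<open>The weights of the strips \<open>k \<le> n\<close> add up to at most
    \<open>2 powr a\<close>, so an error of \<open>\<epsilon>\<close> in each height costs at most
    \<open>\<delta> / 2\<close>.\<close>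
  define \<epsilon> where "\<epsilon> = \<delta> / (2 * 2 powr a)"
  have "\<epsilon> > 0" using assms by (auto simp: \<epsilon>_def)
  have "continuous_on {-1..2} \<phi>"
    unfolding \<phi>_def using assms by (intro continuous_on_powr' continuous_intros) auto
  then have "uniformly_continuous_on {-1..2} \<phi>"
    by (intro compact_uniformly_continuous) auto
  with \<open>\<epsilon> > 0\<close> obtain d where "d > 0"
    and d: "\<And>y z. y \<in> {-1..2} \<Longrightarrow> z \<in> {-1..2} \<Longrightarrow> dist z y < d \<Longrightarrow> dist (\<phi> z) (\<phi> y) < \<epsilon>"
    unfolding uniformly_continuous_on_def by metis
  \<comment> \<open>The arguments \<open>1 - x k + h\<close> and \<open>1 - x (Suc k)\<close>
    compared below are \<open>2 / n\<close> apart.\<close>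
  obtain n :: nat where n: "n > 0" "2 / real n < d"
  proof -
    obtain n :: nat where "2 / d < real n" using reals_Archimedean2 by blast
    moreover have "2 / d > 0" using \<open>d > 0\<close> by simp
    ultimately show ?thesis using that[of n] \<open>d > 0\<close> by (cases "n = 0") (auto simp: field_simps)
  qed
  define h where "h = 1 / real n"
  have h: "0 < h" "h \<le> 1" "2 * h < d" using n by (auto simp: h_def)
  define x where "x = (\<lambda>k. real k / real n)"
  define D where "D = (\<lambda>k. x (Suc k) powr a - x k powr a)"
  have x01: "0 \<le> x k" "k \<le> n \<Longrightarrow> x k \<le> 1" "x (Suc k) = x k + h" for k
    using n by (auto simp: x_def h_def divide_simps)
  have D0: "D k \<ge> 0" for k
    using x01[of k] assms h by (auto simp: D_def intro!: powr_mono2)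
  have diff: "\<phi> (1 - x k + h) - \<phi> (1 - x (Suc k)) \<le> \<epsilon>" if "k \<le> n" for k
  proof -
    have "dist (\<phi> (1 - x k + h)) (\<phi> (1 - x (Suc k))) < \<epsilon>"
      using x01[of k] that h by (intro d) (auto simp: dist_real_def)
    then show ?thesis by (simp add: dist_real_def)
  qed
  define L where "L = (\<Sum>k\<le>n. D k * \<phi> (1 - x (Suc k)))"
  define U where "U = (\<Sum>k\<le>n. D k * \<phi> (1 - x k + h))"
  have "U - L = (\<Sum>k\<le>n. D k * (\<phi> (1 - x k + h) - \<phi> (1 - x (Suc k))))"
    by (simp add: U_def L_def sum_subtractf algebra_simps)
  also have "\<dots> \<le> (\<Sum>k\<le>n. D k * \<epsilon>)"
    by (intro sum_mono mult_left_mono diff D0) auto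
  also have "\<dots> = (x (Suc n) powr a - x 0 powr a) * \<epsilon>"
    unfolding D_def sum_distrib_right[symmetric]
    using sum_lessThan_telescope[of "\<lambda>k. x k powr a" "Suc n"] by (simp add: lessThan_Suc_atMost)
  also have "\<dots> \<le> 2 powr a * \<epsilon>"
  proof -
    have "x (Suc n) \<le> 2" using x01[of n] h by auto
    then have "x (Suc n) powr a \<le> 2 powr a" using assms x01(1) by (intro powr_mono2) auto
    then show ?thesis
      using \<open>\<epsilon> > 0\<close> powr_ge_zero[of "x 0" a] by (intro mult_right_mono) linarith+
  qed
  also have "\<dots> < \<delta>" using assms by (simp add: \<epsilon>_def)
  finally have UL: "U - L < \<delta>" .
  \<comment> \<open>The term \<open>k = n\<close> vanishes because \<open>\<phi>\<close> is 0 at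
    \<open>- 1 / n\<close>.\<close>
  have Leq: "L = (\<Sum>k<n. D k * (1 - x (Suc k)) powr b)"
  proof -
    have "L = (\<Sum>k<n. D k * \<phi> (1 - x (Suc k)))"
      using n by (simp add: L_def lessThan_Suc_atMost[symmetric] \<phi>_def x_def field_simps max_def)
    also have "\<dots> = (\<Sum>k<n. D k * (1 - x (Suc k)) powr b)"
      using x01(2)[of "Suc _"] by (intro sum.cong) (auto simp: \<phi>_def max_def)
    finally show ?thesis .
  qed
  have Ueq: "U = (\<Sum>k\<le>n. D k * (1 - x k + h) powr b)"
    unfolding U_def \<phi>_def using x01 h by (intro sum.cong) (auto simp: max_def add_nonneg_nonneg)
  define I where "I = a * Beta a (b + 1)"
  define f where "f = (\<lambda>x. a * x powr (a - 1) * (1 - x) powr b)"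
  have I: "integral {0..1} f = I"
    unfolding f_def I_def using assms by (intro integral_unique powr_Beta_has_integral)
  have "x n = 1" using n by (simp add: x_def)
  have "L \<le> I \<and> I \<le> (\<Sum>k<n. D k * (1 - x k) powr b)"
    using powr_Beta_Riemann_sandwich[OF assms(1,2) n(1) order_refl] \<open>x n = 1\<close> I
    unfolding Leq D_def x_def f_def by auto
  moreover have "(\<Sum>k<n. D k * (1 - x k) powr b) \<le> U"
  proof -
    have "(\<Sum>k<n. D k * (1 - x k) powr b) \<le> (\<Sum>k<n. D k * (1 - x k + h) powr b)"
      using x01 D0 assms h by (intro sum_mono mult_left_mono powr_mono2) (auto simp: less_imp_le)
    also have "\<dots> \<le> U"
      unfolding Ueq using D0 by (intro sum_mono2) auto
    finally show ?thesis .
  qed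
  ultimately have "I - \<delta> < L" "U < I + \<delta>" using UL by auto
  with n(1) show ?thesis
    by (intro that[of n]) (auto simp: Leq Ueq I_def D_def x_def h_def)
qed

section \<open>Mass of a small simplex from the masses of small rectangles\<close>

context prob_space
begin

lemma prob_rectangle_strip:
  fixes S1 S2 :: "'a \<Rightarrow> real"
  assumes [measurable]: "S1 \<in> borel_measurable M" "S2 \<in> borel_measurable M"
    and "s \<le> t"
  shows "prob {\<omega> \<in> space M. s \<le> S1 \<omega> \<and> S1 \<omega> < t \<and> S2 \<omega> < y} =
         prob {\<omega> \<in> space M. S1 \<omega> < t \<and> S2 \<omega> < y} - prob {\<omega> \<in> space M. S1 \<omega> < s \<and> S2 \<omega> < y}"
proof -
  have "{\<omega> \<in> space M. s \<le> S1 \<omega> \<and> S1 \<omega> < t \<and> S2 \<omega> < y} =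
        {\<omega> \<in> space M. S1 \<omega> < t \<and> S2 \<omega> < y} - {\<omega> \<in> space M. S1 \<omega> < s \<and> S2 \<omega> < y}"
    by auto
  then show ?thesis
    using \<open>s \<le> t\<close> by (simp add: finite_measure_Diff subset_iff)
qed

text \<open>Strips over \<open>[k / n, (k + 1) / n)\<close> with the smaller height are disjoint and
  stay inside the simplex; with the larger height they cover it. The cover needs
  \<open>k = n\<close> for the case \<open>S1 \<omega> = e\<close>, and the extra
  \<open>1 / n\<close> because \<open>S2\<close> is bounded strictly in \<open>G\<close> but not in
  the simplex.\<close>

lemma prob_simplex_sandwich:
  fixes S1 S2 :: "'a \<Rightarrow> real" and n :: nat
  assumes [measurable]: "S1 \<in> borel_measurable M" "S2 \<in> borel_measurable M"
    and nonneg: "AE \<omega> in M. 0 \<le> S1 \<omega> \<and> 0 \<le> S2 \<omega>"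
    and "n > 0" "e > 0"
  defines "G \<equiv> \<lambda>x y. prob {\<omega> \<in> space M. S1 \<omega> < e * x \<and> S2 \<omega> < e * y}"
  shows "(\<Sum>k<n. G (real (Suc k) / n) (1 - real (Suc k) / n) - G (k / n) (1 - real (Suc k) / n))
           \<le> prob {\<omega> \<in> space M. S1 \<omega> + S2 \<omega> \<le> e}" (is "?L \<le> ?T")
    and "prob {\<omega> \<in> space M. S1 \<omega> + S2 \<omega> \<le> e} \<le>
         (\<Sum>k\<le>n. G (real (Suc k) / n) (1 - k / n + 1 / n) - G (k / n) (1 - k / n + 1 / n))" (is "_ \<le> ?U")
proof -
  define A where "A = (\<lambda>k y. {\<omega> \<in> space M. e * (real k / n) \<le> S1 \<omega> \<and> S1 \<omega> < e * (real (Suc k) / n) \<and> S2 \<omega> < e * y})"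
  have [measurable]: "A k y \<in> sets M" for k y unfolding A_def by measurable
  have G: "G (real (Suc k) / n) y - G (k / n) y = prob (A k y)" for k :: nat and y
    unfolding G_def A_def
    by (subst prob_rectangle_strip) (use assms in \<open>auto intro!: mult_left_mono divide_right_mono\<close>)
  \<comment> \<open>Membership in \<open>A k y\<close> forces \<open>k\<close> to be the integer
    part of \<open>n * S1 \<omega> / e\<close>, so strips with different \<open>k\<close> cannot
    meet.\<close>
  have floor: "real k \<le> real n * S1 \<omega> / e \<and> real n * S1 \<omega> / e < real (Suc k)" if "\<omega> \<in> A k y" for k y \<omega>
    using that assms by (auto simp: A_def field_simps)
  have "disjoint_family_on (\<lambda>k. A k (1 - real (Suc k) / n)) {..<n}"
  proof (unfold disjoint_family_on_def, intro ballI impI, rule ccontr)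
    fix k l assume "k \<noteq> l" "A k (1 - real (Suc k) / n) \<inter> A l (1 - real (Suc l) / n) \<noteq> {}"
    then obtain \<omega> where w: "\<omega> \<in> A k (1 - real (Suc k) / n)" "\<omega> \<in> A l (1 - real (Suc l) / n)" by blast
    have "real k < real (Suc l)" "real l < real (Suc k)"
      using floor[OF w(1)] floor[OF w(2)] by linarith+
    with \<open>k \<noteq> l\<close> show False by simp
  qed
  then have "?L = prob (\<Union>k<n. A k (1 - real (Suc k) / n))"
    unfolding G by (intro finite_measure_finite_Union[symmetric]) auto
  also have "\<dots> \<le> ?T"
    by (intro finite_measure_mono) (auto simp: A_def algebra_simps)
  finally show "?L \<le> ?T" .
  have "?T \<le> prob (\<Union>k\<le>n. A k (1 - k / n + 1 / n))"
  proof (rule finite_measure_mono_AE)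
    show "AE \<omega> in M. \<omega> \<in> {\<omega> \<in> space M. S1 \<omega> + S2 \<omega> \<le> e} \<longrightarrow> \<omega> \<in> (\<Union>k\<le>n. A k (1 - k / n + 1 / n))"
      using nonneg
    proof eventually_elim
      fix \<omega> assume *: "0 \<le> S1 \<omega> \<and> 0 \<le> S2 \<omega>"
      show "\<omega> \<in> {\<omega> \<in> space M. S1 \<omega> + S2 \<omega> \<le> e} \<longrightarrow> \<omega> \<in> (\<Union>k\<le>n. A k (1 - k / n + 1 / n))"
      proof
        assume w: "\<omega> \<in> {\<omega> \<in> space M. S1 \<omega> + S2 \<omega> \<le> e}"
        define z where "z = real n * S1 \<omega> / e"
        define k where "k = nat \<lfloor>z\<rfloor>"
        have S1: "S1 \<omega> = e * (z / n)" using assms by (simp add: z_def)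
        have "0 \<le> z" using * assms by (auto simp: z_def)
        then have z: "real k \<le> z" "z < real (Suc k)" unfolding k_def by linarith+
        have "S1 \<omega> \<le> e" using w * by auto
        then have "z \<le> real n" using assms by (auto simp: z_def field_simps)
        with z have "k \<le> n" by linarith
        have zn: "k / n \<le> z / n" "z / n < real (Suc k) / n"
          using z \<open>n > 0\<close> by (auto intro: divide_right_mono divide_strict_right_mono)
        have "S2 \<omega> \<le> e * (1 - z / n)" using w S1 by (simp add: algebra_simps)
        also have "\<dots> < e * (1 - k / n + 1 / n)"
          using zn \<open>e > 0\<close> by (intro mult_strict_left_mono) (auto simp: add_divide_distrib)
        finally have "S2 \<omega> < e * (1 - k / n + 1 / n)" .
        moreover have "e * (k / n) \<le> S1 \<omega>" "S1 \<omega> < e * (real (Suc k) / n)"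
          unfolding S1 using zn \<open>e > 0\<close> by (intro mult_left_mono mult_strict_left_mono; simp)+
        ultimately have "\<omega> \<in> A k (1 - k / n + 1 / n)"
          using w by (simp add: A_def)
        with \<open>k \<le> n\<close> show "\<omega> \<in> (\<Union>k\<le>n. A k (1 - k / n + 1 / n))" by blast
      qed
    qed
  qed measurable
  also have "\<dots> \<le> (\<Sum>k\<le>n. prob (A k (1 - k / n + 1 / n)))"
    by (intro finite_measure_subadditive_finite) auto
  also have "\<dots> = ?U" unfolding G ..
  finally show "?T \<le> ?U" .
qed

text \<open>For fixed \<open>n\<close> the strip bounds are finite sums of rectangle probabilities,
  so the limits in \<open>lim\<close> pass through them. The mesh is fixed first, by the precision
  wanted, and only then does \<open>e\<close> go to 0; pointwise limits in \<open>x\<close> and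
  \<open>y\<close> therefore suffice.\<close>

lemma tendsto_prob_sum_small_Beta:
  fixes S1 S2 :: "'a \<Rightarrow> real" and a b C :: real
  assumes [measurable]: "S1 \<in> borel_measurable M" "S2 \<in> borel_measurable M"
    and nonneg: "AE \<omega> in M. 0 \<le> S1 \<omega> \<and> 0 \<le> S2 \<omega>"
    and "a > 0" "b > 0" "C > 0"
    and lim: "\<And>x y. x > 0 \<Longrightarrow> y > 0 \<Longrightarrow>
      ((\<lambda>e. prob {\<omega> \<in> space M. S1 \<omega> < e * x \<and> S2 \<omega> < e * y} / e powr (a + b)) \<longlongrightarrow>
         C * x powr a * y powr b) (at_right 0)"
  shows "((\<lambda>e. prob {\<omega> \<in> space M. S1 \<omega> + S2 \<omega> \<le> e} / e powr (a + b)) \<longlongrightarrow>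
           C * (a * Beta a (b + 1))) (at_right 0)"
proof -
  define G where "G = (\<lambda>e x y. prob {\<omega> \<in> space M. S1 \<omega> < e * x \<and> S2 \<omega> < e * y})"
  define T where "T = (\<lambda>e. prob {\<omega> \<in> space M. S1 \<omega> + S2 \<omega> \<le> e})"
  define I where "I = a * Beta a (b + 1)"
  \<comment> \<open>Sides of length 0 occur in the sums (\<open>k = 0\<close>, and
    \<open>k = n - 1\<close> in the lower sum) but not in \<open>lim\<close>. Such rectangles have
    probability 0, in agreement with \<open>0 powr a = 0\<close>.\<close>
  have G0: "G e x y = 0" if "x = 0 \<or> y = 0" for e x y
  proof -
    have "AE \<omega> in M. \<not> (S1 \<omega> < e * x \<and> S2 \<omega> < e * y)"
      using nonneg by eventually_elim (use that in auto)
    then show ?thesis unfolding G_def by (subst prob_eq_0) auto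
  qed
  have lim0: "((\<lambda>e. G e x y / e powr (a + b)) \<longlongrightarrow> C * (x powr a * y powr b)) (at_right 0)"
    if "x \<ge> 0" "y \<ge> 0" for x y
  proof (cases "x = 0 \<or> y = 0")
    case True
    then show ?thesis by (auto simp: G0)
  next
    case False
    then show ?thesis using lim[of x y] that by (simp add: G_def mult.assoc)
  qed
  have limD: "((\<lambda>e. (G e x' y - G e x y) / e powr (a + b)) \<longlongrightarrow> C * ((x' powr a - x powr a) * y powr b)) (at_right 0)"
    if "x \<ge> 0" "x' \<ge> 0" "y \<ge> 0" for x x' y
    using tendsto_diff[OF lim0[OF that(2,3)] lim0[OF that(1,3)]]
    by (simp add: diff_divide_distrib algebra_simps)
  have pos: "eventually (\<lambda>e::real. e > 0) (at_right 0)"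
    by (simp add: eventually_at_right_less)
  have "((\<lambda>e. T e / e powr (a + b)) \<longlongrightarrow> C * I) (at_right 0)"
  proof (rule order_tendstoI)
    fix l assume "l < C * I"
    \<comment> \<open>This gap is the precision asked of the lower Riemann sum, which then exceeds
      \<open>l / C\<close>; multiplication by \<open>C\<close> turns that into
      \<open>l\<close>.\<close>
    then have *: "I - l / C > 0" using \<open>C > 0\<close> by (simp add: field_simps)
    obtain n :: nat where n: "n > 0"
      "I - (I - l / C) < (\<Sum>k<n. ((real (Suc k) / n) powr a - (k / n) powr a) * (1 - real (Suc k) / n) powr b)"
      using powr_Beta_Riemann_sums[OF \<open>a > 0\<close> \<open>b > 0\<close> *, folded I_def] by blast
    let ?L = "\<lambda>e. \<Sum>k<n. (G e (real (Suc k) / n) (1 - real (Suc k) / n) - G e (k / n) (1 - real (Suc k) / n)) / e powr (a + b)"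
    have "(?L \<longlongrightarrow> (\<Sum>k<n. C * (((real (Suc k) / n) powr a - (k / n) powr a) * (1 - real (Suc k) / n) powr b))) (at_right 0)"
      by (intro tendsto_sum limD) (auto simp: field_simps)
    moreover have "l < (\<Sum>k<n. C * (((real (Suc k) / n) powr a - (k / n) powr a) * (1 - real (Suc k) / n) powr b))"
      using n(2) \<open>C > 0\<close> unfolding sum_distrib_left[symmetric] by (simp add: pos_divide_less_eq mult.commute)
    ultimately have "eventually (\<lambda>e. l < ?L e) (at_right 0)"
      by (rule order_tendstoD(1))
    with pos show "eventually (\<lambda>e. l < T e / e powr (a + b)) (at_right 0)"
    proof eventually_elim
      case (elim e)
      have "?L e \<le> T e / e powr (a + b)"
        unfolding sum_divide_distrib[symmetric] T_def G_def
        by (intro divide_right_mono prob_simplex_sandwich(1)) (use assms n elim in auto)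
      with elim show ?case by linarith
    qed
  next
    fix u assume "C * I < u"
    then have *: "u / C - I > 0" using \<open>C > 0\<close> by (simp add: field_simps)
    obtain n :: nat where n: "n > 0"
      "(\<Sum>k\<le>n. ((real (Suc k) / n) powr a - (k / n) powr a) * (1 - k / n + 1 / n) powr b) < I + (u / C - I)"
      using powr_Beta_Riemann_sums[OF \<open>a > 0\<close> \<open>b > 0\<close> *, folded I_def] by blast
    let ?U = "\<lambda>e. \<Sum>k\<le>n. (G e (real (Suc k) / n) (1 - k / n + 1 / n) - G e (k / n) (1 - k / n + 1 / n)) / e powr (a + b)"
    have "(?U \<longlongrightarrow> (\<Sum>k\<le>n. C * (((real (Suc k) / n) powr a - (k / n) powr a) * (1 - k / n + 1 / n) powr b))) (at_right 0)"
      using n by (intro tendsto_sum limD) (auto simp: field_simps)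
    moreover have "(\<Sum>k\<le>n. C * (((real (Suc k) / n) powr a - (k / n) powr a) * (1 - k / n + 1 / n) powr b)) < u"
      using n(2) \<open>C > 0\<close> unfolding sum_distrib_left[symmetric] by (simp add: pos_less_divide_eq mult.commute)
    ultimately have "eventually (\<lambda>e. ?U e < u) (at_right 0)"
      by (rule order_tendstoD(2))
    with pos show "eventually (\<lambda>e. T e / e powr (a + b) < u) (at_right 0)"
    proof eventually_elim
      case (elim e)
      have "T e / e powr (a + b) \<le> ?U e"
        unfolding sum_divide_distrib[symmetric] T_def G_def
        by (intro divide_right_mono prob_simplex_sandwich(2)) (use assms n elim in auto)
      with elim show ?case by linarith
    qed
  qed
  then show ?thesis unfolding T_def I_def .
qed

text \<open>The rectangle limit does not depend on \<open>y\<close>: on the scale \<open>e\<close>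
  the mass sits on the axis \<open>y = 0\<close>. Hence the simplex can be squeezed between the
  inner rectangle with sides \<open>1 - d\<close> and \<open>d\<close> and the outer strip of width
  \<open>1 + d\<close>, for \<open>d\<close> close to 0.\<close>

lemma tendsto_prob_sum_small_degenerate:
  fixes S1 S2 :: "'a \<Rightarrow> real" and a C :: real
  assumes [measurable]: "S1 \<in> borel_measurable M" "S2 \<in> borel_measurable M"
    and nonneg: "AE \<omega> in M. 0 \<le> S1 \<omega> \<and> 0 \<le> S2 \<omega>"
    and "a > 0"
    and marg: "\<And>x. x > 0 \<Longrightarrow>
      ((\<lambda>e. prob {\<omega> \<in> space M. S1 \<omega> < e * x} / e powr a) \<longlongrightarrow> C * x powr a) (at_right 0)"
    and lim: "\<And>x y. x > 0 \<Longrightarrow> y > 0 \<Longrightarrow>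
      ((\<lambda>e. prob {\<omega> \<in> space M. S1 \<omega> < e * x \<and> S2 \<omega> < e * y} / e powr a) \<longlongrightarrow> C * x powr a) (at_right 0)"
  shows "((\<lambda>e. prob {\<omega> \<in> space M. S1 \<omega> + S2 \<omega> \<le> e} / e powr a) \<longlongrightarrow> C) (at_right 0)"
proof -
  define T where "T = (\<lambda>e. prob {\<omega> \<in> space M. S1 \<omega> + S2 \<omega> \<le> e})"
  have pos: "eventually (\<lambda>e::real. e > 0) (at_right 0)"
    by (simp add: eventually_at_right_less)
  have "((\<lambda>e. T e / e powr a) \<longlongrightarrow> C) (at_right 0)"
  proof (rule order_tendstoI)
    fix l assume "l < C"
    have "((\<lambda>d. C * (1 - d) powr a) \<longlongrightarrow> C * (1 - 0) powr a) (at_right (0::real))"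
      by (intro tendsto_intros) auto
    then have "eventually (\<lambda>d. l < C * (1 - d) powr a) (at_right (0::real))"
      using \<open>l < C\<close> by (intro order_tendstoD(1)) auto
    moreover have "eventually (\<lambda>d::real. d \<in> {0<..<1}) (at_right 0)"
      by (rule eventually_at_right_real) simp
    ultimately have "eventually (\<lambda>d. l < C * (1 - d) powr a \<and> d \<in> {0<..<1}) (at_right (0::real))"
      by eventually_elim auto
    then obtain d :: real where d: "l < C * (1 - d) powr a" "0 < d" "d < 1"
      using eventually_happens[of _ "at_right (0::real)"] by auto
    have "eventually (\<lambda>e. l < prob {\<omega> \<in> space M. S1 \<omega> < e * (1 - d) \<and> S2 \<omega> < e * d} / e powr a) (at_right 0)"
      using lim[of "1 - d" d] d by (intro order_tendstoD(1)) auto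
    then show "eventually (\<lambda>e. l < T e / e powr a) (at_right 0)"
    proof eventually_elim
      case (elim e)
      have "prob {\<omega> \<in> space M. S1 \<omega> < e * (1 - d) \<and> S2 \<omega> < e * d} / e powr a \<le> T e / e powr a"
        unfolding T_def by (intro divide_right_mono finite_measure_mono) (auto simp: algebra_simps)
      with elim show ?case by linarith
    qed
  next
    fix u assume "C < u"
    have "((\<lambda>d. C * (1 + d) powr a) \<longlongrightarrow> C * (1 + 0) powr a) (at_right (0::real))"
      by (intro tendsto_intros) auto
    then have "eventually (\<lambda>d. C * (1 + d) powr a < u) (at_right (0::real))"
      using \<open>C < u\<close> by (intro order_tendstoD(2)) auto
    moreover have "eventually (\<lambda>d::real. d > 0) (at_right 0)"
      by (rule eventually_at_right_less)
    ultimately have "eventually (\<lambda>d. C * (1 + d) powr a < u \<and> d > 0) (at_right (0::real))"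
      by eventually_elim auto
    then obtain d :: real where d: "C * (1 + d) powr a < u" "0 < d"
      using eventually_happens[of _ "at_right (0::real)"] by auto
    have "eventually (\<lambda>e. prob {\<omega> \<in> space M. S1 \<omega> < e * (1 + d)} / e powr a < u) (at_right 0)"
      using marg[of "1 + d"] d by (intro order_tendstoD(2)) auto
    with pos show "eventually (\<lambda>e. T e / e powr a < u) (at_right 0)"
    proof eventually_elim
      case (elim e)
      have "T e / e powr a \<le> prob {\<omega> \<in> space M. S1 \<omega> < e * (1 + d)} / e powr a"
        unfolding T_def
      proof (intro divide_right_mono finite_measure_mono_AE)
        show "AE \<omega> in M. \<omega> \<in> {\<omega> \<in> space M. S1 \<omega> + S2 \<omega> \<le> e} \<longrightarrow> \<omega> \<in> {\<omega> \<in> space M. S1 \<omega> < e * (1 + d)}"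
          using nonneg
        proof eventually_elim
          case (elim \<omega>)
          have "e < e * (1 + d)" using \<open>e > 0\<close> d by simp
          with elim show ?case by auto
        qed
      qed auto
      with elim show ?case by linarith
    qed
  qed
  then show ?thesis unfolding T_def .
qed

end

section \<open>Asymptotics of the rectangle probabilities\<close>

text \<open>Since \<open>\<alpha>2 < \<alpha>1\<close>, the ratio \<open>t1 e / t2 e\<close> tends
  to 0 and the argument of \<open>g\<close> to 1 from the left. There \<open>g\<close> behaves like
  \<open>K * (t1 e / t2 e) powr \<kappa>\<close>, which combines with
  \<open>(t1 e * t2 e) powr \<theta>\<close> to \<open>K * t1 e powr (\<theta> + \<kappa>) * t2 e
  powr (\<theta> - \<kappa>)\<close>.\<close>

lemma tendsto_joint_tail_rectangle:
  fixes g :: "real \<Rightarrow> real" and \<alpha>1 \<alpha>2 u1 u2 x y K \<kappa> \<theta> :: real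
  assumes "\<alpha>2 < \<alpha>1" "u1 > 0" "u2 > 0" "x > 0" "y > 0" "K \<noteq> 0"
    and g: "g \<sim>[at_left 1] (\<lambda>w. K * (1 - w) powr \<kappa>)"
  defines "t1 \<equiv> \<lambda>e. (e * x / u1) powr \<alpha>1" and "t2 \<equiv> \<lambda>e. (e * y / u2) powr \<alpha>2"
  shows "((\<lambda>e. (t1 e * t2 e) powr \<theta> * g (t2 e / (t1 e + t2 e)) / e powr (\<alpha>1 * (\<theta> + \<kappa>) + \<alpha>2 * (\<theta> - \<kappa>)))
    \<longlongrightarrow> K * (x / u1) powr (\<alpha>1 * (\<theta> + \<kappa>)) * (y / u2) powr (\<alpha>2 * (\<theta> - \<kappa>))) (at_right 0)"
proof -
  \<comment> \<open>The quotient as the definition of \<open>\<sim>\<close> reads it, with 1 in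
    place of 0/0. At \<open>W e\<close> it is the ordinary quotient, since
    \<open>1 - W e > 0\<close> and \<open>K \<noteq> 0\<close>.\<close>
  define \<rho> where "\<rho> = (\<lambda>w. if g w = 0 \<and> K * (1 - w) powr \<kappa> = 0 then 1 else g w / (K * (1 - w) powr \<kappa>))"
  have \<rho>: "(\<rho> \<longlongrightarrow> 1) (at_left 1)"
    using asymp_equivD[OF g] by (simp add: \<rho>_def)
  \<comment> \<open>For \<open>e > 0\<close>, \<open>q e\<close> is the ratio
    \<open>t1 e / t2 e\<close>, \<open>D\<close> is its constant factor, and \<open>W e\<close> is
    the argument of \<open>g\<close>.\<close>
  define D where "D = (x / u1) powr \<alpha>1 / (y / u2) powr \<alpha>2"
  define q where "q = (\<lambda>e. D * e powr (\<alpha>1 - \<alpha>2))"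
  define W where "W = (\<lambda>e. 1 / (1 + q e))"
  define c where "c = (x / u1) powr (\<alpha>1 * (\<theta> + \<kappa>)) * (y / u2) powr (\<alpha>2 * (\<theta> - \<kappa>))"
  have "D > 0" using assms by (simp add: D_def)
  have pos: "eventually (\<lambda>e::real. e > 0) (at_right 0)"
    by (rule eventually_at_right_less)
  have "((\<lambda>e::real. e powr (\<alpha>1 - \<alpha>2)) \<longlongrightarrow> 0) (at_right 0)"
    using \<open>\<alpha>2 < \<alpha>1\<close> pos
    by (intro tendsto_zero_powrI[where b = "\<alpha>1 - \<alpha>2"] tendsto_const) (auto elim: eventually_mono)
  from tendsto_mult_left[OF this, of D] have q: "(q \<longlongrightarrow> 0) (at_right 0)"
    by (simp add: q_def)
  have qpos: "eventually (\<lambda>e. q e > 0) (at_right 0)"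
    using pos by eventually_elim (use \<open>D > 0\<close> in \<open>simp add: q_def\<close>)
  have "(W \<longlongrightarrow> 1 / (1 + 0)) (at_right 0)"
    unfolding W_def by (intro tendsto_intros q) auto
  moreover have "eventually (\<lambda>e. W e < 1) (at_right 0)"
    using qpos by eventually_elim (simp add: W_def)
  ultimately have "filterlim W (at_left 1) (at_right 0)"
    by (intro tendsto_imp_filterlim_at_left) auto
  with \<rho> have "((\<lambda>e. \<rho> (W e)) \<longlongrightarrow> 1) (at_right 0)"
    by (rule filterlim_compose)
  moreover have "((\<lambda>e. (1 + q e) powr (- \<kappa>)) \<longlongrightarrow> (1 + 0) powr (- \<kappa>)) (at_right 0)"
    by (intro tendsto_intros q) auto
  ultimately have "((\<lambda>e. \<rho> (W e) * (K * c * (1 + q e) powr (- \<kappa>))) \<longlongrightarrow> 1 * (K * c * (1 + 0) powr (- \<kappa>))) (at_right 0)"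
    by (rule tendsto_mult[OF _ tendsto_mult[OF tendsto_const]])
  moreover have "eventually (\<lambda>e. \<rho> (W e) * (K * c * (1 + q e) powr (- \<kappa>)) =
      (t1 e * t2 e) powr \<theta> * g (t2 e / (t1 e + t2 e)) / e powr (\<alpha>1 * (\<theta> + \<kappa>) + \<alpha>2 * (\<theta> - \<kappa>))) (at_right 0)"
    using pos qpos
  proof eventually_elim
    case (elim e)
    have t: "t1 e > 0" "t2 e > 0" using assms elim by (auto simp: t1_def t2_def)
    have t1: "t1 e = (x / u1) powr \<alpha>1 * e powr \<alpha>1"
      using assms elim by (simp add: t1_def powr_mult[symmetric] mult.commute)
    have t2: "t2 e = (y / u2) powr \<alpha>2 * e powr \<alpha>2"
      using assms elim by (simp add: t2_def powr_mult[symmetric] mult.commute)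
    have qe: "q e = t1 e / t2 e"
      by (simp add: q_def D_def t1 t2 powr_diff)
    have W: "W e = t2 e / (t1 e + t2 e)" "1 - W e = q e / (1 + q e)"
      using t by (auto simp: W_def qe field_simps)
    have "1 - W e > 0" unfolding W(2) using elim by simp
    then have "g (W e) = \<rho> (W e) * (K * (1 - W e) powr \<kappa>)"
      using \<open>K \<noteq> 0\<close> by (simp add: \<rho>_def)
    also have "(1 - W e) powr \<kappa> = q e powr \<kappa> * (1 + q e) powr (- \<kappa>)"
      using elim by (simp add: W(2) powr_divide powr_minus divide_simps)
    finally have "(t1 e * t2 e) powr \<theta> * g (W e) =
        \<rho> (W e) * (K * ((t1 e * t2 e) powr \<theta> * (t1 e / t2 e) powr \<kappa>) * (1 + q e) powr (- \<kappa>))"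
      by (simp add: qe)
    also have "(t1 e * t2 e) powr \<theta> * (t1 e / t2 e) powr \<kappa> = t1 e powr (\<theta> + \<kappa>) * t2 e powr (\<theta> - \<kappa>)"
      using t by (simp add: powr_mult powr_divide powr_add powr_diff)
    also have "\<dots> = c * e powr (\<alpha>1 * (\<theta> + \<kappa>) + \<alpha>2 * (\<theta> - \<kappa>))"
    proof -
      have "t1 e powr (\<theta> + \<kappa>) = (x / u1) powr (\<alpha>1 * (\<theta> + \<kappa>)) * e powr (\<alpha>1 * (\<theta> + \<kappa>))"
        "t2 e powr (\<theta> - \<kappa>) = (y / u2) powr (\<alpha>2 * (\<theta> - \<kappa>)) * e powr (\<alpha>2 * (\<theta> - \<kappa>))"
        unfolding t1 t2 by (simp_all add: powr_mult powr_powr)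
      then show ?thesis by (simp add: c_def powr_add)
    qed
    finally show ?case using elim by (simp add: W(1))
  qed
  ultimately show ?thesis
    by (simp add: c_def mult.assoc tendsto_cong)
qed

section \<open>Limits of homogeneous functions of order -1\<close>

text \<open>The function \<open>\<psi> z = H (1 / z) 1 = z * H 1 z\<close> has derivative \<open>- partial1 H 1 z\<close>, so both
  claims are instances of l'Hopital's rule: for \<open>\<psi> z / z\<close> at infinity and for \<open>(\<psi> z - 1) / z\<close> at 0.\<close>

lemma
  fixes H :: "real \<Rightarrow> real \<Rightarrow> real"
  assumes hom: "\<And>k x y. k > 0 \<Longrightarrow> x > 0 \<Longrightarrow> y > 0 \<Longrightarrow> H (k * x) (k * y) = H x y / k"
    and diff: "\<And>x y. x > 0 \<Longrightarrow> y > 0 \<Longrightarrow> (\<lambda>s. H s y) differentiable (at x)"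
  shows partial1_homogeneous_limit:
      "\<lbrakk>((\<lambda>z. H 1 z) \<longlongrightarrow> 1) at_top; ((\<lambda>z. partial1 H 1 z) \<longlongrightarrow> l) at_top\<rbrakk> \<Longrightarrow> l = -1"
    and homogeneous_asymp_equiv_sqrt:
      "\<lbrakk>((\<lambda>z. H z 1) \<longlongrightarrow> 1) at_top; ((\<lambda>z. partial1 H 1 z) \<longlongrightarrow> 0) (at_right 0)\<rbrakk> \<Longrightarrow>
       (\<lambda>w. w powr (- 1 / 2) * (1 - w) powr (- 1 / 2) * (1 - H (1 / (1 - w)) (1 / w)))
         \<sim>[at_left 1] (\<lambda>w. (1 - w) powr (1 / 2))"
proof -
  define \<psi> where "\<psi> = (\<lambda>z. z * H 1 z)"
  have \<psi>: "\<psi> z = H (1 / z) 1" if "z > 0" for z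
    using hom[of "1 / z" 1 z] that by (simp add: \<psi>_def)
  \<comment> \<open>For fixed \<open>z\<close>, homogeneity gives
    \<open>\<psi> s = z * H (z / s) z\<close>. Only the first argument varies here, and it is 1 at
    \<open>s = z\<close>, so the derivative involves \<open>partial1 H\<close> at
    \<open>(1, z)\<close> alone.\<close>
  have deriv: "(\<psi> has_real_derivative - partial1 H 1 z) (at z)" if "z > 0" for z
  proof -
    have "((\<lambda>s. H s z) has_real_derivative partial1 H 1 z) (at 1)"
      using diff[of 1 z] that unfolding partial1_def
      by (simp add: DERIV_deriv_iff_real_differentiable)
    moreover have "((\<lambda>s. z / s) has_real_derivative - (1 / z)) (at z)"
      using that by (auto intro!: derivative_eq_intros simp: power2_eq_square)
    ultimately have "((\<lambda>s. H (z / s) z) has_real_derivative partial1 H 1 z * - (1 / z)) (at z)"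
      using DERIV_chain2[of "\<lambda>s. H s z" "partial1 H 1 z" "\<lambda>s. z / s" z "- (1 / z)" UNIV] that by simp
    then have "((\<lambda>s. z * H (z / s) z) has_real_derivative z * (partial1 H 1 z * - (1 / z))) (at z)"
      by (rule DERIV_cmult)
    then have *: "((\<lambda>s. z * H (z / s) z) has_real_derivative - partial1 H 1 z) (at z)"
      using that by simp
    show ?thesis
    proof (rule has_field_derivative_transform_within_open[OF *])
      show "z * H (z / s) z = \<psi> s" if "s \<in> {0<..}" for s
        using hom[of z "1 / s" 1] \<psi>[of s] that \<open>z > 0\<close> by simp
    qed (use that in auto)
  qed
  show "l = -1" if H1: "((\<lambda>z. H 1 z) \<longlongrightarrow> 1) at_top" and l: "((\<lambda>z. partial1 H 1 z) \<longlongrightarrow> l) at_top"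
  proof -
    have pos: "eventually (\<lambda>z::real. z > 0) at_top" by (rule eventually_gt_at_top)
    \<comment> \<open>The quotient is \<open>H 1 z\<close>, whose limit 1 is known; comparing the
      two limits yields \<open>- l = 1\<close>.\<close>
    have "((\<lambda>z. \<psi> z / z) \<longlongrightarrow> - l) at_top"
    proof (rule lhospital_at_top_at_top[where f' = "\<lambda>z. - partial1 H 1 z" and g' = "\<lambda>_. 1"])
      show "((\<lambda>z. - partial1 H 1 z / 1) \<longlongrightarrow> - l) at_top"
        using tendsto_minus[OF l] by simp
      show "eventually (\<lambda>z. (\<psi> has_real_derivative - partial1 H 1 z) (at z)) at_top"
        using pos by eventually_elim (rule deriv)
    qed (auto simp: filterlim_ident)
    moreover have "eventually (\<lambda>z. \<psi> z / z = H 1 z) at_top"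
      using pos by eventually_elim (simp add: \<psi>_def)
    ultimately have "((\<lambda>z. H 1 z) \<longlongrightarrow> - l) at_top"
      by (rule Lim_transform_eventually)
    from tendsto_unique[OF _ this H1] show ?thesis by simp
  qed
  show "(\<lambda>w. w powr (- 1 / 2) * (1 - w) powr (- 1 / 2) * (1 - H (1 / (1 - w)) (1 / w)))
         \<sim>[at_left 1] (\<lambda>w. (1 - w) powr (1 / 2))"
    if H2: "((\<lambda>z. H z 1) \<longlongrightarrow> 1) at_top" and l0: "((\<lambda>z. partial1 H 1 z) \<longlongrightarrow> 0) (at_right 0)"
  proof -
    have pos: "eventually (\<lambda>z::real. z > 0) (at_right 0)" by (rule eventually_at_right_less)
    have "((\<lambda>z. H (inverse z) 1) \<longlongrightarrow> 1) (at_right 0)"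
      using H2 filterlim_inverse_at_top_right by (rule filterlim_compose)
    moreover have "eventually (\<lambda>z. H (inverse z) 1 = \<psi> z) (at_right 0)"
      using pos by eventually_elim (simp add: \<psi> inverse_eq_divide)
    ultimately have \<psi>1: "(\<psi> \<longlongrightarrow> 1) (at_right 0)"
      by (rule Lim_transform_eventually)
    have Q: "((\<lambda>z. (\<psi> z - 1) / z) \<longlongrightarrow> 0) (at_right 0)"
    proof (rule lhopital_right_0[where f' = "\<lambda>z. - partial1 H 1 z" and g' = "\<lambda>_. 1"])
      show "((\<lambda>z. \<psi> z - 1) \<longlongrightarrow> 0) (at_right 0)"
        using tendsto_diff[OF \<psi>1 tendsto_const[of 1]] by simp
      show "((\<lambda>z. - partial1 H 1 z / 1) \<longlongrightarrow> 0) (at_right 0)"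
        using tendsto_minus[OF l0] by simp
      show "eventually (\<lambda>z. z \<noteq> (0::real)) (at_right 0)"
        using pos by eventually_elim simp
      show "eventually (\<lambda>z. ((\<lambda>z. \<psi> z - 1) has_real_derivative - partial1 H 1 z) (at z)) (at_right 0)"
        using pos
      proof eventually_elim
        case (elim z)
        show ?case using DERIV_diff[OF deriv[OF elim] DERIV_const[of 1]] by simp
      qed
    qed auto
    have w: "eventually (\<lambda>w::real. w \<in> {0<..<1}) (at_left 1)"
      by (rule eventually_at_left_real) simp
    \<comment> \<open>With \<open>z = (1 - w) / w\<close>, homogeneity gives
      \<open>H (1 / (1 - w)) (1 / w) = w * \<psi> z\<close>, and \<open>1 - w * \<psi> z\<close>
      equals \<open>(1 - w) * (1 - (\<psi> z - 1) / z)\<close>. By \<open>Q\<close> the second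
      factor tends to 1.\<close>
    have "((\<lambda>w. (1 - w) / w) \<longlongrightarrow> (1 - 1) / 1) (at_left (1::real))"
      by (intro tendsto_intros) auto
    then have "filterlim (\<lambda>w. (1 - w) / w) (at_right 0) (at_left (1::real))"
      by (intro tendsto_imp_filterlim_at_right) (use w in \<open>auto elim: eventually_mono\<close>)
    from filterlim_compose[OF Q this]
    have "((\<lambda>w. w powr (- 1 / 2) * (1 - (\<psi> ((1 - w) / w) - 1) / ((1 - w) / w))) \<longlongrightarrow> 1 powr (- 1 / 2) * (1 - 0)) (at_left (1::real))"
      by (intro tendsto_intros) auto
    moreover have "eventually (\<lambda>w. w powr (- 1 / 2) * (1 - (\<psi> ((1 - w) / w) - 1) / ((1 - w) / w)) =
      w powr (- 1 / 2) * (1 - w) powr (- 1 / 2) * (1 - H (1 / (1 - w)) (1 / w)) / (1 - w) powr (1 / 2)) (at_left (1::real))"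
      using w
    proof eventually_elim
      case (elim w)
      then have w: "0 < w" "w < 1" by auto
      have "H (1 / (1 - w)) (1 / w) = w * H (w / (1 - w)) 1"
        using hom[of "1 / w" "w / (1 - w)" 1] w by simp
      also have "\<dots> = w * \<psi> ((1 - w) / w)"
        using \<psi>[of "(1 - w) / w"] w by simp
      finally have H: "H (1 / (1 - w)) (1 / w) = w * \<psi> ((1 - w) / w)" .
      have "(1 - w) powr (- 1 / 2) / (1 - w) powr (1 / 2) = 1 / (1 - w)"
        using w by (simp add: powr_minus_divide powr_half_sqrt)
      then have "w powr (- 1 / 2) * (1 - w) powr (- 1 / 2) * z / (1 - w) powr (1 / 2) =
          w powr (- 1 / 2) * (z / (1 - w))" for z
        by (metis mult.assoc times_divide_eq_left times_divide_eq_right mult.commute mult_1)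
      moreover have "1 - (\<psi> ((1 - w) / w) - 1) / ((1 - w) / w) = (1 - w * \<psi> ((1 - w) / w)) / (1 - w)"
        using w by (simp add: divide_simps) (simp add: algebra_simps)
      ultimately show ?case unfolding H by simp
    qed
    ultimately show ?thesis
      by (intro asymp_equivI') (simp add: tendsto_cong)
  qed
qed

section \<open>Margins and joint tail near the upper endpoints\<close>

text \<open>The variable \<open>s\<close> is the distance to the upper endpoint. At
  \<open>s = 0\<close> the power is 0, which later shows that no mass lies beyond the
  endpoint.\<close>

lemma gpd_cdf_near_endpoint:
  assumes "\<sigma> > 0" "\<xi> < 0" "0 \<le> s" "s < - \<sigma> / \<xi>"
  shows "1 - gpd_cdf \<sigma> \<xi> (- \<sigma> / \<xi> - s) = (s / (- \<sigma> / \<xi>)) powr (- 1 / \<xi>)"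
proof -
  have "1 + \<xi> * (- \<sigma> / \<xi> - s) / \<sigma> = s / (- \<sigma> / \<xi>)"
    using assms by (simp add: field_simps)
  moreover have "s / (- \<sigma> / \<xi>) \<ge> 0"
    using assms by (intro divide_nonneg_pos) (auto simp: divide_neg_neg divide_pos_neg)
  ultimately show ?thesis
    using assms by (simp add: gpd_cdf_def)
qed

text \<open>Here \<open>t1\<close> and \<open>t2\<close> are the marginal tails
  \<open>1 / y1\<close> and \<open>1 / y2\<close> of the tail model, as functions of the distances
  from the endpoints. Hence \<open>y1 / (y1 + y2)\<close> becomes \<open>t2 / (t1 + t2)\<close>,
  with the indices exchanged.\<close>

lemma joint_tail_model_near_endpoint:
  assumes "joint_tail_model M X1 X2 \<sigma>1 \<xi>1 \<sigma>2 \<xi>2 \<eta> g"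
    and F: "cdf (distr M borel X1) = gpd_cdf \<sigma>1 \<xi>1" "cdf (distr M borel X2) = gpd_cdf \<sigma>2 \<xi>2"
    and pos: "\<sigma>1 > 0" "\<sigma>2 > 0" "\<xi>1 < 0" "\<xi>2 < 0"
  defines "u1 \<equiv> - \<sigma>1 / \<xi>1" and "u2 \<equiv> - \<sigma>2 / \<xi>2"
    and "t1 \<equiv> \<lambda>s. (s / (- \<sigma>1 / \<xi>1)) powr (- 1 / \<xi>1)" and "t2 \<equiv> \<lambda>s. (s / (- \<sigma>2 / \<xi>2)) powr (- 1 / \<xi>2)"
  obtains \<delta> where "\<delta> > 0"
    "\<forall>s1>0. \<forall>s2>0. s1 + s2 < \<delta> \<longrightarrow>
      measure M {\<omega> \<in> space M. u1 - X1 \<omega> < s1 \<and> u2 - X2 \<omega> < s2} =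
      (t1 s1 * t2 s2) powr (1 / (2 * \<eta>)) * g (t2 s2 / (t1 s1 + t2 s2))"
proof -
  from assms(1) obtain L v c where L: "v > 0" "\<And>y. y > v \<Longrightarrow> L y = 1"
    and c: "0 < c" "c < - (\<sigma>1 / \<xi>1 + \<sigma>2 / \<xi>2)"
    and eq: "\<And>x1 x2. 0 < x1 \<Longrightarrow> x1 < - \<sigma>1 / \<xi>1 \<Longrightarrow> 0 < x2 \<Longrightarrow> x2 < - \<sigma>2 / \<xi>2 \<Longrightarrow>
      x1 + x2 \<ge> max c (max (- \<sigma>1 / \<xi>1) (- \<sigma>2 / \<xi>2)) \<Longrightarrow>
      measure M {\<omega> \<in> space M. X1 \<omega> > x1 \<and> X2 \<omega> > x2} =
        joint_tail_form L \<eta> g (1 / (1 - gpd_cdf \<sigma>1 \<xi>1 x1)) (1 / (1 - gpd_cdf \<sigma>2 \<xi>2 x2))"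
    unfolding joint_tail_model_def Let_def F by blast
  have u: "u1 > 0" "u2 > 0" using pos by (auto simp: u1_def u2_def divide_neg_neg divide_pos_neg)
  have u': "u1 = - \<sigma>1 / \<xi>1" "u2 = - \<sigma>2 / \<xi>2" by (auto simp: u1_def u2_def)
  have c': "c < u1 + u2" using c(2) by (simp add: u')
  \<comment> \<open>Chosen so that the tail \<open>t1\<close> at distance \<open>d\<close> is
    \<open>1 / (v + 1)\<close>: for \<open>s1 < d\<close> this gives \<open>y1 > v + 1\<close>,
    hence \<open>L (y1 + y2) = 1\<close>.\<close>
  define d where "d = u1 * (v + 1) powr \<xi>1"
  have "d > 0" using u L by (simp add: d_def)
  \<comment> \<open>With \<open>x1 = u1 - s1\<close> and \<open>x2 = u2 - s2\<close>, the bounds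
    \<open>min u1 u2\<close> and \<open>u1 + u2 - c\<close> ensure
    \<open>x1 + x2 \<ge> max c (max u1 u2)\<close>; the first of them also keeps \<open>x1\<close>
    and \<open>x2\<close> positive.\<close>
  define \<delta> where "\<delta> = min d (min (min u1 u2) (u1 + u2 - c))"
  have "\<delta> > 0" using u c' \<open>d > 0\<close> by (simp add: \<delta>_def)
  moreover have "measure M {\<omega> \<in> space M. u1 - X1 \<omega> < s1 \<and> u2 - X2 \<omega> < s2} =
      (t1 s1 * t2 s2) powr (1 / (2 * \<eta>)) * g (t2 s2 / (t1 s1 + t2 s2))"
    if s: "s1 > 0" "s2 > 0" "s1 + s2 < \<delta>" for s1 s2
  proof -
    have s': "s1 < u1" "s2 < u2" "s1 < d" "s1 + s2 < u1 + u2 - c" "s1 + s2 < u1" "s1 + s2 < u2"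
      using s by (auto simp: \<delta>_def)
    have t: "t1 s1 > 0" "t2 s2 > 0"
      using s pos by (auto simp: t1_def t2_def)
    have "v < 1 / t1 s1 + 1 / t2 s2"
    proof -
      have "t1 s1 < (d / u1) powr (- 1 / \<xi>1)"
        unfolding t1_def u'[symmetric]
        using s s' u pos by (intro powr_less_mono2 divide_strict_right_mono) (auto simp: divide_neg_neg divide_pos_neg)
      also have "\<dots> = 1 / (v + 1)"
        using u L pos by (simp add: d_def powr_powr powr_minus_divide)
      finally have "v + 1 < 1 / t1 s1" using L t by (simp add: field_simps)
      moreover have "0 < 1 / t2 s2" using t by simp
      ultimately show ?thesis by linarith
    qed
    then have L1: "L (1 / t1 s1 + 1 / t2 s2) = 1" by (rule L)
    have F1: "1 - gpd_cdf \<sigma>1 \<xi>1 (u1 - s1) = t1 s1"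
      using gpd_cdf_near_endpoint[of \<sigma>1 \<xi>1 s1] pos s s' by (simp add: u' t1_def)
    have F2: "1 - gpd_cdf \<sigma>2 \<xi>2 (u2 - s2) = t2 s2"
      using gpd_cdf_near_endpoint[of \<sigma>2 \<xi>2 s2] pos s s' by (simp add: u' t2_def)
    have "max c (max u1 u2) \<le> (u1 - s1) + (u2 - s2)"
      using s s' by auto
    then have "measure M {\<omega> \<in> space M. X1 \<omega> > u1 - s1 \<and> X2 \<omega> > u2 - s2} =
        joint_tail_form L \<eta> g (1 / t1 s1) (1 / t2 s2)"
      using eq[of "u1 - s1" "u2 - s2", folded u'] s s' u unfolding F1 F2 by auto
    also have "\<dots> = (1 / t1 s1 * (1 / t2 s2)) powr (- 1 / (2 * \<eta>)) * g (1 / t1 s1 / (1 / t1 s1 + 1 / t2 s2))"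
      by (simp add: joint_tail_form_def L1)
    also have "(1 / t1 s1 * (1 / t2 s2)) powr (- 1 / (2 * \<eta>)) = (t1 s1 * t2 s2) powr (1 / (2 * \<eta>))"
      using t by (simp add: powr_minus_divide powr_divide powr_mult)
    also have "1 / t1 s1 / (1 / t1 s1 + 1 / t2 s2) = t2 s2 / (t1 s1 + t2 s2)"
      using t by (simp add: field_simps)
    finally show ?thesis
      by (simp add: less_diff_eq diff_less_eq add.commute)
  qed
  ultimately show ?thesis by (intro that allI impI) simp_all
qed

text \<open>The substitution is \<open>e = b - r\<close>, and \<open>b - r = b * (1 - r / b)\<close>
  produces the factor \<open>b powr p\<close>, which appears as a power of \<open>rF\<close> in the
  constants.\<close>

lemma asymp_equiv_at_left_from_right_0:
  fixes P :: "real \<Rightarrow> real"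
  assumes lim: "((\<lambda>e. T e / e powr p) \<longlongrightarrow> C) (at_right 0)" and "C \<noteq> 0" "b > 0"
    and P: "\<And>r. P r = T (b - r)"
  shows "P \<sim>[at_left b] (\<lambda>r. C * b powr p * (1 - r / b) powr p)"
proof (rule asymp_equivI')
  have less: "eventually (\<lambda>r. r < b) (at_left b)"
    by (simp add: eventually_at_filter)
  have "((\<lambda>r. b - r) \<longlongrightarrow> b - b) (at_left b)"
    by (intro tendsto_intros)
  then have "filterlim (\<lambda>r. b - r) (at_right 0) (at_left b)"
    by (intro tendsto_imp_filterlim_at_right) (use less in \<open>auto elim: eventually_mono\<close>)
  from filterlim_compose[OF lim this]
  have "((\<lambda>r. T (b - r) / (b - r) powr p / C) \<longlongrightarrow> C / C) (at_left b)"
    using \<open>C \<noteq> 0\<close> by (intro tendsto_divide tendsto_const)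
  moreover have "eventually (\<lambda>r. T (b - r) / (b - r) powr p / C =
      P r / (C * b powr p * (1 - r / b) powr p)) (at_left b)"
    using less
  proof eventually_elim
    case (elim r)
    have "b powr p * (1 - r / b) powr p = (b * (1 - r / b)) powr p"
      using elim \<open>b > 0\<close> by (simp add: powr_mult)
    also have "b * (1 - r / b) = b - r" using \<open>b > 0\<close> by (simp add: algebra_simps)
    finally show ?case by (simp add: P mult.assoc mult.commute)
  qed
  ultimately show "((\<lambda>r. P r / (C * b powr p * (1 - r / b) powr p)) \<longlongrightarrow> 1) (at_left b)"
    using \<open>C \<noteq> 0\<close> by (simp add: tendsto_cong)
qed

lemma (in prob_space) prob_greater_eq_cdf:
  assumes [measurable]: "X \<in> borel_measurable M"
  shows "prob {\<omega> \<in> space M. X \<omega> > x} = 1 - cdf (distr M borel X) x"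
proof -
  have "cdf (distr M borel X) x = prob {\<omega> \<in> space M. X \<omega> \<le> x}"
    by (simp add: cdf_def measure_distr vimage_def Int_def conj_commute)
  also have "\<dots> = 1 - prob {\<omega> \<in> space M. X \<omega> > x}"
    using prob_neg[of "\<lambda>\<omega>. X \<omega> > x"] by (simp add: not_less)
  finally show ?thesis by simp
qed

lemma (in prob_space) gpd_AE_le_endpoint:
  assumes [measurable]: "X \<in> borel_measurable M"
    and F: "cdf (distr M borel X) = gpd_cdf \<sigma> \<xi>" and "\<sigma> > 0" "\<xi> < 0"
  shows "AE \<omega> in M. 0 \<le> - \<sigma> / \<xi> - X \<omega>"
proof -
  have "- \<sigma> / \<xi> > 0" using assms by (simp add: divide_neg_neg divide_pos_neg)
  then have "prob {\<omega> \<in> space M. X \<omega> > - \<sigma> / \<xi>} = 0"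
    using gpd_cdf_near_endpoint[of \<sigma> \<xi> 0] assms by (simp add: prob_greater_eq_cdf F)
  then have "AE \<omega> in M. \<not> X \<omega> > - \<sigma> / \<xi>"
    by (subst (asm) prob_eq_0) auto
  then show ?thesis by eventually_elim auto
qed

section \<open>Tail of the sum when the first component has the larger shape parameter\<close>

text \<open>As \<open>\<xi>2 < \<xi>1\<close>, the tail probability of \<open>X2\<close> dominates that of \<open>X1\<close> at comparable distances
  from the endpoints, so the argument of \<open>g\<close> tends to 1 and its behaviour at 0 is irrelevant. The
  second claim is the borderline case in which the limit measure degenerates.\<close>

lemma (in prob_space) gpd_sum_tail:
  fixes X1 X2 :: "'a \<Rightarrow> real" and g :: "real \<Rightarrow> real" and \<sigma>1 \<sigma>2 \<xi>1 \<xi>2 \<eta> \<delta> K \<kappa> :: real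
  assumes meas [measurable]: "X1 \<in> borel_measurable M" "X2 \<in> borel_measurable M"
    and F: "cdf (distr M borel X1) = gpd_cdf \<sigma>1 \<xi>1" "cdf (distr M borel X2) = gpd_cdf \<sigma>2 \<xi>2"
    and pos: "\<sigma>1 > 0" "\<sigma>2 > 0" and \<xi>: "\<xi>2 < \<xi>1" "\<xi>1 < 0" and "\<eta> > 0"
    and g: "g \<sim>[at_left 1] (\<lambda>w. K * (1 - w) powr \<kappa>)" and "K > 0" "\<kappa> \<ge> 0"
    and "\<delta> > 0"
    and tail: "\<forall>s1>0. \<forall>s2>0. s1 + s2 < \<delta> \<longrightarrow>
      prob {\<omega> \<in> space M. - \<sigma>1 / \<xi>1 - X1 \<omega> < s1 \<and> - \<sigma>2 / \<xi>2 - X2 \<omega> < s2} =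
      ((s1 / (- \<sigma>1 / \<xi>1)) powr (- 1 / \<xi>1) * (s2 / (- \<sigma>2 / \<xi>2)) powr (- 1 / \<xi>2)) powr (1 / (2 * \<eta>)) *
      g ((s2 / (- \<sigma>2 / \<xi>2)) powr (- 1 / \<xi>2) / ((s1 / (- \<sigma>1 / \<xi>1)) powr (- 1 / \<xi>1) + (s2 / (- \<sigma>2 / \<xi>2)) powr (- 1 / \<xi>2)))"
  defines "b \<equiv> - (\<sigma>1 / \<xi>1 + \<sigma>2 / \<xi>2)"
  shows gpd_sum_tail_power:
      "\<kappa> < 1 / (2 * \<eta>) \<Longrightarrow> K2 K \<eta> \<kappa> \<xi>1 \<xi>2 \<sigma>1 \<sigma>2 b > 0 \<and>
        (\<lambda>r. prob {\<omega> \<in> space M. X1 \<omega> + X2 \<omega> \<ge> r}) \<sim>[at_left b]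
          (\<lambda>r. K2 K \<eta> \<kappa> \<xi>1 \<xi>2 \<sigma>1 \<sigma>2 b *
            (1 - r / b) powr (- 1 / \<xi>1 * (1 / (2 * \<eta>) + \<kappa>) - 1 / \<xi>2 * (1 / (2 * \<eta>) - \<kappa>)))"
    and gpd_sum_tail_degenerate:
      "\<kappa> = 1 / (2 * \<eta>) \<Longrightarrow> \<eta> = 1 \<Longrightarrow> K = 1 \<Longrightarrow>
        (\<lambda>r. prob {\<omega> \<in> space M. X1 \<omega> + X2 \<omega> \<ge> r}) \<sim>[at_left b]
          (\<lambda>r. (- \<xi>1) powr (- 1 / \<xi>1) * b powr (- 1 / \<xi>1) * \<sigma>1 powr (1 / \<xi>1) * (1 - r / b) powr (- 1 / \<xi>1))"
proof -
  define \<theta> where "\<theta> = 1 / (2 * \<eta>)"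
  define u1 where "u1 = - \<sigma>1 / \<xi>1"
  define u2 where "u2 = - \<sigma>2 / \<xi>2"
  define \<alpha>1 where "\<alpha>1 = - 1 / \<xi>1"
  define \<alpha>2 where "\<alpha>2 = - 1 / \<xi>2"
  \<comment> \<open>\<open>\<beta>1\<close> and \<open>\<beta>2\<close> are the exponents of the two
    sides in the limit of the rectangle probabilities. \<open>\<beta>2\<close> is positive for
    \<open>\<kappa> < \<theta>\<close> and 0 for \<open>\<kappa> = \<theta>\<close>, which separates
    the two claims.\<close>
  define \<beta>1 where "\<beta>1 = \<alpha>1 * (\<theta> + \<kappa>)"
  define \<beta>2 where "\<beta>2 = \<alpha>2 * (\<theta> - \<kappa>)"
  define S1 where "S1 = (\<lambda>\<omega>. u1 - X1 \<omega>)"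
  define S2 where "S2 = (\<lambda>\<omega>. u2 - X2 \<omega>)"
  define T where "T = (\<lambda>e. prob {\<omega> \<in> space M. S1 \<omega> + S2 \<omega> \<le> e})"
  have u: "u1 > 0" "u2 > 0" using pos \<xi> by (auto simp: u1_def u2_def divide_neg_neg divide_pos_neg)
  have \<alpha>: "\<alpha>2 > 0" "\<alpha>2 < \<alpha>1" using \<xi> by (auto simp: \<alpha>1_def \<alpha>2_def divide_neg_neg divide_pos_neg field_simps)
  have "\<theta> > 0" using \<open>\<eta> > 0\<close> by (simp add: \<theta>_def)
  have "\<beta>1 > 0" using \<alpha> \<open>\<theta> > 0\<close> \<open>\<kappa> \<ge> 0\<close> by (simp add: \<beta>1_def)
  have [measurable]: "S1 \<in> borel_measurable M" "S2 \<in> borel_measurable M"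
    by (auto simp: S1_def S2_def)
  have b: "b = u1 + u2" by (simp add: b_def u1_def u2_def)
  then have "b > 0" using u by simp
  have P: "prob {\<omega> \<in> space M. X1 \<omega> + X2 \<omega> \<ge> r} = T (b - r)" for r
    unfolding T_def S1_def S2_def b by (intro arg_cong[where f = prob]) auto
  have nonneg: "AE \<omega> in M. 0 \<le> S1 \<omega> \<and> 0 \<le> S2 \<omega>"
    using gpd_AE_le_endpoint[OF meas(1) F(1)] gpd_AE_le_endpoint[OF meas(2) F(2)] pos \<xi>
    unfolding S1_def S2_def u1_def u2_def by auto
  have small: "eventually (\<lambda>e::real. e > 0 \<and> e * c < d) (at_right 0)" if "d > 0" for c d :: real
  proof -
    have "((\<lambda>e::real. e * c) \<longlongrightarrow> 0 * c) (at_right 0)" by (intro tendsto_intros)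
    then have "eventually (\<lambda>e. e * c < d) (at_right 0)" using that by (intro order_tendstoD(2)) auto
    with eventually_at_right_less[of "0::real"] show ?thesis by eventually_elim simp
  qed
  have lim: "((\<lambda>e. prob {\<omega> \<in> space M. S1 \<omega> < e * x \<and> S2 \<omega> < e * y} / e powr (\<beta>1 + \<beta>2)) \<longlongrightarrow>
      K * (1 / u1) powr \<beta>1 * (1 / u2) powr \<beta>2 * x powr \<beta>1 * y powr \<beta>2) (at_right 0)"
    if xy: "x > 0" "y > 0" for x y
  proof -
    have "eventually (\<lambda>e. e > 0 \<and> e * (x + y) < \<delta>) (at_right 0)"
      using \<open>\<delta> > 0\<close> by (rule small)
    then have "eventually (\<lambda>e.
        ((e * x / u1) powr \<alpha>1 * (e * y / u2) powr \<alpha>2) powr \<theta> *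
        g ((e * y / u2) powr \<alpha>2 / ((e * x / u1) powr \<alpha>1 + (e * y / u2) powr \<alpha>2)) / e powr (\<beta>1 + \<beta>2) =
        prob {\<omega> \<in> space M. S1 \<omega> < e * x \<and> S2 \<omega> < e * y} / e powr (\<beta>1 + \<beta>2)) (at_right 0)"
    proof eventually_elim
      case (elim e)
      then show ?case
        using tail[rule_format, of "e * x" "e * y"] xy
        by (simp add: S1_def S2_def u1_def u2_def \<alpha>1_def \<alpha>2_def \<theta>_def distrib_left)
    qed
    moreover have "((\<lambda>e. ((e * x / u1) powr \<alpha>1 * (e * y / u2) powr \<alpha>2) powr \<theta> *
        g ((e * y / u2) powr \<alpha>2 / ((e * x / u1) powr \<alpha>1 + (e * y / u2) powr \<alpha>2)) / e powr (\<beta>1 + \<beta>2)) \<longlongrightarrow>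
        K * (x / u1) powr \<beta>1 * (y / u2) powr \<beta>2) (at_right 0)"
      unfolding \<beta>1_def \<beta>2_def
      by (rule tendsto_joint_tail_rectangle) (use \<alpha> u xy g \<open>K > 0\<close> in auto)
    ultimately have "((\<lambda>e. prob {\<omega> \<in> space M. S1 \<omega> < e * x \<and> S2 \<omega> < e * y} / e powr (\<beta>1 + \<beta>2)) \<longlongrightarrow>
        K * (x / u1) powr \<beta>1 * (y / u2) powr \<beta>2) (at_right 0)"
      by (rule Lim_transform_eventually[rotated])
    also have "K * (x / u1) powr \<beta>1 * (y / u2) powr \<beta>2 =
        K * (1 / u1) powr \<beta>1 * (1 / u2) powr \<beta>2 * x powr \<beta>1 * y powr \<beta>2"
      using xy u by (simp add: powr_divide)
    finally show ?thesis .
  qed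
  show "K2 K \<eta> \<kappa> \<xi>1 \<xi>2 \<sigma>1 \<sigma>2 b > 0 \<and>
      (\<lambda>r. prob {\<omega> \<in> space M. X1 \<omega> + X2 \<omega> \<ge> r}) \<sim>[at_left b]
        (\<lambda>r. K2 K \<eta> \<kappa> \<xi>1 \<xi>2 \<sigma>1 \<sigma>2 b *
          (1 - r / b) powr (- 1 / \<xi>1 * (1 / (2 * \<eta>) + \<kappa>) - 1 / \<xi>2 * (1 / (2 * \<eta>) - \<kappa>)))"
    if "\<kappa> < 1 / (2 * \<eta>)"
  proof -
    have "\<beta>2 > 0" using \<alpha> that by (simp add: \<beta>2_def \<theta>_def)
    define C where "C = K * (1 / u1) powr \<beta>1 * (1 / u2) powr \<beta>2"
    define B where "B = Beta \<beta>1 \<beta>2"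
    have "C > 0" using \<open>K > 0\<close> u by (simp add: C_def)
    have "B > 0" using \<open>\<beta>1 > 0\<close> \<open>\<beta>2 > 0\<close>
      unfolding B_def Beta_def by (intro divide_pos_pos mult_pos_pos Gamma_real_pos) auto
    \<comment> \<open>The recurrence trades the shifted argument of the Beta function for a factor,
      as \<open>K2\<close> contains the unshifted value divided by
      \<open>p = \<beta>1 + \<beta>2\<close>.\<close>
    have "(\<beta>1 + \<beta>2) * Beta \<beta>1 (\<beta>2 + 1) = \<beta>2 * B"
      unfolding B_def using \<open>\<beta>2 > 0\<close> by (intro Beta_plus1_right) (auto elim!: nonpos_Ints_cases)
    then have Bp: "Beta \<beta>1 (\<beta>2 + 1) = \<beta>2 * B / (\<beta>1 + \<beta>2)"
      using \<open>\<beta>1 > 0\<close> \<open>\<beta>2 > 0\<close> by (simp add: field_simps)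
    define C' where "C' = C * (\<beta>1 * (\<beta>2 * B / (\<beta>1 + \<beta>2)))"
    have "C' > 0" using \<open>C > 0\<close> \<open>B > 0\<close> \<open>\<beta>1 > 0\<close> \<open>\<beta>2 > 0\<close> by (simp add: C'_def)
    have "((\<lambda>e. T e / e powr (\<beta>1 + \<beta>2)) \<longlongrightarrow> C * (\<beta>1 * Beta \<beta>1 (\<beta>2 + 1))) (at_right 0)"
      unfolding T_def
    proof (rule tendsto_prob_sum_small_Beta)
      show "((\<lambda>e. prob {\<omega> \<in> space M. S1 \<omega> < e * x \<and> S2 \<omega> < e * y} / e powr (\<beta>1 + \<beta>2)) \<longlongrightarrow>
          C * x powr \<beta>1 * y powr \<beta>2) (at_right 0)" if "x > 0" "y > 0" for x y
        using lim[OF that] by (simp add: C_def)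
    qed (use nonneg \<open>\<beta>1 > 0\<close> \<open>\<beta>2 > 0\<close> \<open>C > 0\<close> in auto)
    then have limT: "((\<lambda>e. T e / e powr (\<beta>1 + \<beta>2)) \<longlongrightarrow> C') (at_right 0)"
      unfolding C'_def Bp .
    have K2: "K2 K \<eta> \<kappa> \<xi>1 \<xi>2 \<sigma>1 \<sigma>2 b = C' * b powr (\<beta>1 + \<beta>2)"
    proof -
      have \<beta>: "- (\<theta> + \<kappa>) / \<xi>1 = \<beta>1" "- (\<theta> - \<kappa>) / \<xi>2 = \<beta>2"
        "(\<theta> + \<kappa>) / \<xi>1 = - \<beta>1" "(\<theta> - \<kappa>) / \<xi>2 = - \<beta>2"
        using \<xi> by (simp_all add: \<beta>1_def \<beta>2_def \<alpha>1_def \<alpha>2_def field_simps)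
      \<comment> \<open>This factor of \<open>K2\<close> is \<open>\<beta>1 * \<beta>2\<close> times
        \<open>\<xi>1 * \<xi>2\<close>; the surplus factors \<open>- \<xi>1\<close> and
        \<open>- \<xi>2\<close> make up for the exponents lowered by 1 in \<open>K2\<close>.\<close>
      have "1 / (4 * \<eta>\<^sup>2) - \<kappa>\<^sup>2 = (\<theta> + \<kappa>) * (\<theta> - \<kappa>)"
        using \<open>\<eta> > 0\<close> by (simp add: \<theta>_def power2_eq_square algebra_simps)
      also have "\<dots> = \<beta>1 * \<beta>2 * (- \<xi>1) * (- \<xi>2)"
        using \<xi> by (simp add: \<beta>1_def \<beta>2_def \<alpha>1_def \<alpha>2_def)
      finally have 1: "1 / (4 * \<eta>\<^sup>2) - \<kappa>\<^sup>2 = \<beta>1 * \<beta>2 * (- \<xi>1) * (- \<xi>2)" .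
      have 2: "(1 / u1) powr \<beta>1 = (- \<xi>1) * (- \<xi>1) powr (\<beta>1 - 1) * \<sigma>1 powr (- \<beta>1)"
        using pos \<xi> by (simp add: u1_def powr_diff powr_minus_divide powr_divide[symmetric])
      have 3: "(1 / u2) powr \<beta>2 = (- \<xi>2) * (- \<xi>2) powr (\<beta>2 - 1) * \<sigma>2 powr (- \<beta>2)"
        using pos \<xi> by (simp add: u2_def powr_diff powr_minus_divide powr_divide[symmetric])
      show ?thesis
        unfolding K2_def Let_def \<theta>_def[symmetric] 1 C'_def C_def 2 3 B_def
        unfolding \<beta> diff_minus_eq_add
        by (simp only: divide_inverse mult_ac)
    qed
    have "- 1 / \<xi>1 * (1 / (2 * \<eta>) + \<kappa>) - 1 / \<xi>2 * (1 / (2 * \<eta>) - \<kappa>) = \<beta>1 + \<beta>2"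
      by (simp add: \<beta>1_def \<beta>2_def \<alpha>1_def \<alpha>2_def \<theta>_def)
    then show ?thesis
      using asymp_equiv_at_left_from_right_0[OF limT _ \<open>b > 0\<close> P] \<open>C' > 0\<close> \<open>b > 0\<close>
      unfolding K2 by simp
  qed
  show "(\<lambda>r. prob {\<omega> \<in> space M. X1 \<omega> + X2 \<omega> \<ge> r}) \<sim>[at_left b]
      (\<lambda>r. (- \<xi>1) powr (- 1 / \<xi>1) * b powr (- 1 / \<xi>1) * \<sigma>1 powr (1 / \<xi>1) * (1 - r / b) powr (- 1 / \<xi>1))"
    if "\<kappa> = 1 / (2 * \<eta>)" "\<eta> = 1" "K = 1"
  proof -
    \<comment> \<open>With \<open>\<eta> = 1\<close>, both \<open>\<theta>\<close> and
      \<open>\<kappa>\<close> are 1/2, so the joint exponent is that of the margin of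
      \<open>X1\<close> alone.\<close>
    have \<beta>: "\<beta>1 = \<alpha>1" "\<beta>2 = 0" using that by (auto simp: \<beta>1_def \<beta>2_def \<theta>_def)
    define C where "C = (1 / u1) powr \<alpha>1"
    have "C > 0" using u by (simp add: C_def)
    have limT: "((\<lambda>e. T e / e powr \<alpha>1) \<longlongrightarrow> C) (at_right 0)"
      unfolding T_def
    proof (rule tendsto_prob_sum_small_degenerate)
      show "((\<lambda>e. prob {\<omega> \<in> space M. S1 \<omega> < e * x \<and> S2 \<omega> < e * y} / e powr \<alpha>1) \<longlongrightarrow>
          C * x powr \<alpha>1) (at_right 0)" if "x > 0" "y > 0" for x y
        using lim[OF that] \<open>K = 1\<close> that u by (simp add: C_def \<beta>)
      \<comment> \<open>The margin is an exact power near its endpoint, so the quotient is constant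
        for small \<open>e\<close>.\<close>
      show "((\<lambda>e. prob {\<omega> \<in> space M. S1 \<omega> < e * x} / e powr \<alpha>1) \<longlongrightarrow> C * x powr \<alpha>1) (at_right 0)"
        if "x > 0" for x
      proof (rule tendsto_eventually)
        show "eventually (\<lambda>e. prob {\<omega> \<in> space M. S1 \<omega> < e * x} / e powr \<alpha>1 = C * x powr \<alpha>1) (at_right 0)"
          using small[OF u(1), of x]
        proof eventually_elim
          case (elim e)
          have "prob {\<omega> \<in> space M. S1 \<omega> < e * x} = prob {\<omega> \<in> space M. X1 \<omega> > u1 - e * x}"
            unfolding S1_def by (intro arg_cong[where f = prob]) auto
          also have "\<dots> = (e * x / u1) powr \<alpha>1"
            using gpd_cdf_near_endpoint[of \<sigma>1 \<xi>1 "e * x"] pos \<xi> elim \<open>x > 0\<close>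
            by (simp add: prob_greater_eq_cdf F u1_def \<alpha>1_def)
          also have "\<dots> = C * x powr \<alpha>1 * e powr \<alpha>1"
            using elim \<open>x > 0\<close> u by (simp add: C_def powr_mult powr_divide)
          finally show ?case using elim by simp
        qed
      qed
    qed (use nonneg \<alpha> in auto)
    have "1 / u1 = (- \<xi>1) / \<sigma>1" by (simp add: u1_def)
    then have "C = (- \<xi>1) powr \<alpha>1 / \<sigma>1 powr \<alpha>1"
      unfolding C_def using pos \<xi> by (simp only: powr_divide)
    then have "C = (- \<xi>1) powr (- 1 / \<xi>1) * \<sigma>1 powr (1 / \<xi>1)"
      by (simp add: \<alpha>1_def powr_minus_divide)
    then show ?thesis
      using asymp_equiv_at_left_from_right_0[OF limT less_imp_neq[OF \<open>C > 0\<close>, symmetric] \<open>b > 0\<close> P]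
      unfolding \<alpha>1_def by (simp add: mult_ac)
  qed
qed

section \<open>Both orders of the shape parameters\<close>

lemma asymp_equiv_reflect_unit:
  fixes f h :: "real \<Rightarrow> real"
  assumes "f \<sim>[at_right 0] h"
  shows "(\<lambda>w. f (1 - w)) \<sim>[at_left 1] (\<lambda>w. h (1 - w))"
proof -
  have "((\<lambda>w. 1 - w) \<longlongrightarrow> 1 - 1) (at_left (1::real))"
    by (intro tendsto_intros)
  then have "filterlim (\<lambda>w. 1 - w) (at_right 0) (at_left (1::real))"
    by (intro tendsto_imp_filterlim_at_right) (auto simp: eventually_at_filter)
  with assms show ?thesis by (rule asymp_equiv_compose')
qed

theorem theorem3:
  fixes M :: "'a measure" and X1 X2 R :: "'a \<Rightarrow> real"
    and f :: "real \<times> real \<Rightarrow> ennreal" and g :: "real \<Rightarrow> real"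
    and \<sigma>1 \<sigma>2 \<xi>1 \<xi>2 \<eta> rF \<xi>max \<xi>min \<sigma>M \<sigma>m :: real
  defines "R \<equiv> \<lambda>\<omega>. X1 \<omega> + X2 \<omega>"
    and "rF \<equiv> - (\<sigma>1 / \<xi>1 + \<sigma>2 / \<xi>2)"
    and "\<xi>max \<equiv> max \<xi>1 \<xi>2"
    and "\<xi>min \<equiv> min \<xi>1 \<xi>2"
    and "\<sigma>M \<equiv> (if \<xi>1 = max \<xi>1 \<xi>2 then \<sigma>1 else \<sigma>2)"
    and "\<sigma>m \<equiv> (if \<xi>1 = min \<xi>1 \<xi>2 then \<sigma>1 else \<sigma>2)"
  assumes "prob_space M"
    and "\<sigma>1 > 0" and "\<sigma>2 > 0"
    and "1 / 2 \<le> \<eta>" and "\<eta> \<le> 1"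
    and "\<xi>1 \<noteq> \<xi>2" and "max \<xi>1 \<xi>2 < 0"
    and "X1 \<in> borel_measurable M" and "X2 \<in> borel_measurable M"
    and "AE \<omega> in M. X1 \<omega> > 0 \<and> X2 \<omega> > 0"
    and "distributed M lborel (\<lambda>\<omega>. (X1 \<omega>, X2 \<omega>)) f"
    and "cdf (distr M borel X1) = gpd_cdf \<sigma>1 \<xi>1"
    and "cdf (distr M borel X2) = gpd_cdf \<sigma>2 \<xi>2"
    and "joint_tail_model M X1 X2 \<sigma>1 \<xi>1 \<sigma>2 \<xi>2 \<eta> g"
  shows "(\<forall>Kg \<kappa>. condition2 \<eta> g Kg \<kappa> \<longrightarrow>
            K2 Kg \<eta> \<kappa> \<xi>max \<xi>min \<sigma>M \<sigma>m rF > 0 \<and>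
            (\<lambda>r. measure M {\<omega> \<in> space M. R \<omega> \<ge> r}) \<sim>[at_left rF]
              (\<lambda>r. K2 Kg \<eta> \<kappa> \<xi>max \<xi>min \<sigma>M \<sigma>m rF *
                   (1 + \<xi>1 * \<xi>2 * r / (\<sigma>1 * \<xi>2 + \<sigma>2 * \<xi>1)) powr
                     (- 1 / \<xi>max * (1 / (2 * \<eta>) + \<kappa>) - 1 / \<xi>min * (1 / (2 * \<eta>) - \<kappa>)))) \<and>
         (\<forall>H. condition3b \<eta> g H \<xi>1 \<xi>2 \<longrightarrow>
            K3b H \<sigma>1 \<xi>1 \<sigma>2 \<xi>2 rF > 0 \<and>
            (\<lambda>r. measure M {\<omega> \<in> space M. R \<omega> \<ge> r}) \<sim>[at_left rF]
              (\<lambda>r. K3b H \<sigma>1 \<xi>1 \<sigma>2 \<xi>2 rF *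
                   (1 + \<xi>1 * \<xi>2 * r / (\<sigma>1 * \<xi>2 + \<sigma>2 * \<xi>1)) powr (- 1 / \<xi>max)))"
proof -
  interpret prob_space M by fact
  note pos = \<open>\<sigma>1 > 0\<close> \<open>\<sigma>2 > 0\<close>
  note meas = \<open>X1 \<in> borel_measurable M\<close> \<open>X2 \<in> borel_measurable M\<close>
  note F = \<open>cdf (distr M borel X1) = gpd_cdf \<sigma>1 \<xi>1\<close> \<open>cdf (distr M borel X2) = gpd_cdf \<sigma>2 \<xi>2\<close>
  have \<xi>: "\<xi>1 < 0" "\<xi>2 < 0" using \<open>max \<xi>1 \<xi>2 < 0\<close> by auto
  have "\<eta> > 0" using \<open>1 / 2 \<le> \<eta>\<close> by simp
  \<comment> \<open>The base of the powers in the claim is the relative distance to the endpoint of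
    the sum, the form in which the tail of the sum was computed.\<close>
  have base: "1 + \<xi>1 * \<xi>2 * r / (\<sigma>1 * \<xi>2 + \<sigma>2 * \<xi>1) = 1 - r / rF" for r
  proof -
    have "rF = - ((\<sigma>1 * \<xi>2 + \<sigma>2 * \<xi>1) / (\<xi>1 * \<xi>2))"
      using \<xi> by (simp add: rF_def field_simps)
    then show ?thesis by simp
  qed
  have "\<sigma>1 / \<xi>1 < 0" "\<sigma>2 / \<xi>2 < 0" using pos \<xi> by (auto simp: divide_pos_neg)
  then have "rF > 0" unfolding rF_def by linarith
  obtain \<delta> where "\<delta> > 0" and tail: "\<forall>s1>0. \<forall>s2>0. s1 + s2 < \<delta> \<longrightarrow>
      prob {\<omega> \<in> space M. - \<sigma>1 / \<xi>1 - X1 \<omega> < s1 \<and> - \<sigma>2 / \<xi>2 - X2 \<omega> < s2} =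
      ((s1 / (- \<sigma>1 / \<xi>1)) powr (- 1 / \<xi>1) * (s2 / (- \<sigma>2 / \<xi>2)) powr (- 1 / \<xi>2)) powr (1 / (2 * \<eta>)) *
      g ((s2 / (- \<sigma>2 / \<xi>2)) powr (- 1 / \<xi>2) / ((s1 / (- \<sigma>1 / \<xi>1)) powr (- 1 / \<xi>1) + (s2 / (- \<sigma>2 / \<xi>2)) powr (- 1 / \<xi>2)))"
    by (rule joint_tail_model_near_endpoint
        [OF \<open>joint_tail_model M X1 X2 \<sigma>1 \<xi>1 \<sigma>2 \<xi>2 \<eta> g\<close> F pos \<xi>]) blast
  consider "\<xi>2 < \<xi>1" | "\<xi>1 < \<xi>2" using \<open>\<xi>1 \<noteq> \<xi>2\<close> by linarith
  then show ?thesis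
  proof cases
    case 1
    then have defs: "\<xi>max = \<xi>1" "\<xi>min = \<xi>2" "\<sigma>M = \<sigma>1" "\<sigma>m = \<sigma>2"
      by (auto simp: \<xi>max_def \<xi>min_def \<sigma>M_def \<sigma>m_def)
    note sum_tail = gpd_sum_tail_power[OF meas F pos 1 \<xi>(1) \<open>\<eta> > 0\<close> _ _ _ \<open>\<delta> > 0\<close> tail, folded rF_def]
      gpd_sum_tail_degenerate[OF meas F pos 1 \<xi>(1) \<open>\<eta> > 0\<close> _ _ _ \<open>\<delta> > 0\<close> tail, folded rF_def]
    show ?thesis
      unfolding defs base R_def
    proof (intro conjI allI impI)
      fix Kg \<kappa> assume "condition2 \<eta> g Kg \<kappa>"
      then have "g \<sim>[at_left 1] (\<lambda>w. Kg * (1 - w) powr \<kappa>)" "Kg > 0" "\<kappa> \<ge> 0" "\<kappa> < 1 / (2 * \<eta>)"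
        by (auto simp: condition2_def)
      from sum_tail(1)[OF this]
      show "K2 Kg \<eta> \<kappa> \<xi>1 \<xi>2 \<sigma>1 \<sigma>2 rF > 0"
        "(\<lambda>r. prob {\<omega> \<in> space M. X1 \<omega> + X2 \<omega> \<ge> r}) \<sim>[at_left rF]
          (\<lambda>r. K2 Kg \<eta> \<kappa> \<xi>1 \<xi>2 \<sigma>1 \<sigma>2 rF *
            (1 - r / rF) powr (- 1 / \<xi>1 * (1 / (2 * \<eta>) + \<kappa>) - 1 / \<xi>2 * (1 / (2 * \<eta>) - \<kappa>)))"
        by blast+
    next
      fix H assume "condition3b \<eta> g H \<xi>1 \<xi>2"
      then have \<eta>: "\<eta> = 1" and H: "\<And>k x y. k > 0 \<Longrightarrow> x > 0 \<Longrightarrow> y > 0 \<Longrightarrow> H (k * x) (k * y) = H x y / k"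
          "\<And>x y. x > 0 \<Longrightarrow> y > 0 \<Longrightarrow> (\<lambda>s. H s y) differentiable (at x)"
        and H_lim: "((\<lambda>z. H z 1) \<longlongrightarrow> 1) at_top" "((\<lambda>z. H 1 z) \<longlongrightarrow> 1) at_top"
        and g: "g \<sim>[at_left 1] (\<lambda>w. w powr (- 1 / 2) * (1 - w) powr (- 1 / 2) * (1 - H (1 / (1 - w)) (1 / w)))"
        and H1: "\<exists>l. ((\<lambda>z. partial1 H 1 z) \<longlongrightarrow> l) at_top" "((\<lambda>z. partial1 H 1 z) \<longlongrightarrow> 0) (at_right 0)"
        using 1 by (auto simp: condition3b_def condition3_def dest!: spec[of _ "1::real"])
      obtain l where l: "((\<lambda>z. partial1 H 1 z) \<longlongrightarrow> l) at_top" using H1 by blast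
      with partial1_homogeneous_limit[OF H H_lim(2)] have "l = -1" by blast
      \<comment> \<open>The absolute value in \<open>K3b\<close> is therefore 1.\<close>
      with l have "Lim at_top (\<lambda>z. partial1 H 1 z) = -1" by (intro tendsto_Lim) auto
      then have K: "K3b H \<sigma>1 \<xi>1 \<sigma>2 \<xi>2 rF = (- \<xi>1) powr (- 1 / \<xi>1) * rF powr (- 1 / \<xi>1) * \<sigma>1 powr (1 / \<xi>1)"
        using 1 by (simp add: K3b_def)
      show "K3b H \<sigma>1 \<xi>1 \<sigma>2 \<xi>2 rF > 0"
        unfolding K using pos \<xi> \<open>rF > 0\<close> by simp
      \<comment> \<open>For \<open>\<eta> = 1\<close> the square root is the power
        \<open>1 / (2 * \<eta>)\<close>, so this is the borderline
        \<open>\<kappa> = 1 / (2 * \<eta>)\<close> with \<open>K = 1\<close>.\<close>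
      have "g \<sim>[at_left 1] (\<lambda>w. 1 * (1 - w) powr (1 / (2 * \<eta>)))"
        using asymp_equiv_trans[OF g homogeneous_asymp_equiv_sqrt[OF H H_lim(1) H1(2)]] by (simp add: \<eta>)
      from sum_tail(2)[OF this _ _ refl \<eta> refl]
      show "(\<lambda>r. prob {\<omega> \<in> space M. X1 \<omega> + X2 \<omega> \<ge> r}) \<sim>[at_left rF]
          (\<lambda>r. K3b H \<sigma>1 \<xi>1 \<sigma>2 \<xi>2 rF * (1 - r / rF) powr (- 1 / \<xi>1))"
        unfolding K using \<open>\<eta> > 0\<close> by simp
    qed
  next
    case 2
    then have defs: "\<xi>max = \<xi>2" "\<xi>min = \<xi>1" "\<sigma>M = \<sigma>2" "\<sigma>m = \<sigma>1"
      by (auto simp: \<xi>max_def \<xi>min_def \<sigma>M_def \<sigma>m_def)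
    have rF: "rF = - (\<sigma>2 / \<xi>2 + \<sigma>1 / \<xi>1)" by (simp add: rF_def)
    have R: "X1 \<omega> + X2 \<omega> = X2 \<omega> + X1 \<omega>" for \<omega> by simp
    \<comment> \<open>Exchanging the components sends the argument \<open>w\<close> of
      \<open>g\<close> to \<open>1 - w\<close>, so the result for the first order of the shapes is
      applied to the reflected function.\<close>
    have tail': "\<forall>s2>0. \<forall>s1>0. s2 + s1 < \<delta> \<longrightarrow> prob {\<omega> \<in> space M. - \<sigma>2 / \<xi>2 - X2 \<omega> < s2 \<and> - \<sigma>1 / \<xi>1 - X1 \<omega> < s1} =
      ((s2 / (- \<sigma>2 / \<xi>2)) powr (- 1 / \<xi>2) * (s1 / (- \<sigma>1 / \<xi>1)) powr (- 1 / \<xi>1)) powr (1 / (2 * \<eta>)) *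
      g (1 - (s1 / (- \<sigma>1 / \<xi>1)) powr (- 1 / \<xi>1) / ((s2 / (- \<sigma>2 / \<xi>2)) powr (- 1 / \<xi>2) + (s1 / (- \<sigma>1 / \<xi>1)) powr (- 1 / \<xi>1)))" (is "\<forall>s2>0. \<forall>s1>0. _ \<longrightarrow> ?P s2 s1")
    proof (intro allI impI)
      fix s2 s1 assume s: "s2 > 0" "s1 > 0" "s2 + s1 < \<delta>"
      define t1 where "t1 = (s1 / (- \<sigma>1 / \<xi>1)) powr (- 1 / \<xi>1)"
      define t2 where "t2 = (s2 / (- \<sigma>2 / \<xi>2)) powr (- 1 / \<xi>2)"
      have "t1 > 0" "t2 > 0" using s pos \<xi> by (auto simp: t1_def t2_def)
      then have "t2 / (t1 + t2) = 1 - t1 / (t2 + t1)" by (simp add: field_simps)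
      moreover have "prob {\<omega> \<in> space M. - \<sigma>1 / \<xi>1 - X1 \<omega> < s1 \<and> - \<sigma>2 / \<xi>2 - X2 \<omega> < s2} =
          (t1 * t2) powr (1 / (2 * \<eta>)) * g (t2 / (t1 + t2))"
        unfolding t1_def t2_def using s by (intro tail[rule_format]) auto
      ultimately show "?P s2 s1"
        unfolding t1_def[symmetric] t2_def[symmetric] by (simp add: conj_commute mult.commute)
    qed
    note sum_tail = gpd_sum_tail_power[where g = "\<lambda>w. g (1 - w)",
        OF meas(2,1) F(2,1) pos(2,1) 2 \<xi>(2) \<open>\<eta> > 0\<close> _ _ _ \<open>\<delta> > 0\<close> tail', folded rF]
      gpd_sum_tail_degenerate[where g = "\<lambda>w. g (1 - w)",
        OF meas(2,1) F(2,1) pos(2,1) 2 \<xi>(2) \<open>\<eta> > 0\<close> _ _ _ \<open>\<delta> > 0\<close> tail', folded rF]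
    show ?thesis
      unfolding defs base R_def R
    proof (intro conjI allI impI)
      fix Kg \<kappa> assume "condition2 \<eta> g Kg \<kappa>"
      then have "g \<sim>[at_right 0] (\<lambda>w. Kg * w powr \<kappa>)" and K: "Kg > 0" "\<kappa> \<ge> 0" "\<kappa> < 1 / (2 * \<eta>)"
        by (auto simp: condition2_def)
      \<comment> \<open>The behaviour of \<open>g\<close> at 0 becomes that of the reflected
        function at 1.\<close>
      from sum_tail(1)[OF asymp_equiv_reflect_unit[OF this(1)] K]
      show "K2 Kg \<eta> \<kappa> \<xi>2 \<xi>1 \<sigma>2 \<sigma>1 rF > 0"
        "(\<lambda>r. prob {\<omega> \<in> space M. X2 \<omega> + X1 \<omega> \<ge> r}) \<sim>[at_left rF]
          (\<lambda>r. K2 Kg \<eta> \<kappa> \<xi>2 \<xi>1 \<sigma>2 \<sigma>1 rF *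
            (1 - r / rF) powr (- 1 / \<xi>2 * (1 / (2 * \<eta>) + \<kappa>) - 1 / \<xi>1 * (1 / (2 * \<eta>) - \<kappa>)))"
        by blast+
    next
      fix H assume "condition3b \<eta> g H \<xi>1 \<xi>2"
      \<comment> \<open>Replacing \<open>w\<close> by \<open>1 - w\<close> swaps the arguments
        \<open>1 / (1 - w)\<close> and \<open>1 / w\<close> of \<open>H\<close>; the transposed
        function restores their order, and its first partial derivative is \<open>partial2 H\<close>
        with swapped arguments.\<close>
      define H' where "H' = (\<lambda>x y. H y x)"
      have partial: "partial2 H z 1 = partial1 H' 1 z" for z
        by (simp add: partial1_def partial2_def H'_def)
      have \<eta>: "\<eta> = 1" and H: "\<And>k x y. k > 0 \<Longrightarrow> x > 0 \<Longrightarrow> y > 0 \<Longrightarrow> H' (k * x) (k * y) = H' x y / k"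
          "\<And>x y. x > 0 \<Longrightarrow> y > 0 \<Longrightarrow> (\<lambda>s. H' s y) differentiable (at x)"
        and H_lim: "((\<lambda>z. H' z 1) \<longlongrightarrow> 1) at_top" "((\<lambda>z. H' 1 z) \<longlongrightarrow> 1) at_top"
        and g: "g \<sim>[at_right 0] (\<lambda>w. w powr (- 1 / 2) * (1 - w) powr (- 1 / 2) * (1 - H (1 / (1 - w)) (1 / w)))"
        and H1: "\<exists>l. ((\<lambda>z. partial1 H' 1 z) \<longlongrightarrow> l) at_top" "((\<lambda>z. partial1 H' 1 z) \<longlongrightarrow> 0) (at_right 0)"
        using 2 \<open>condition3b \<eta> g H \<xi>1 \<xi>2\<close>
        by (auto simp: condition3b_def condition3_def H'_def partial[unfolded H'_def] dest!: spec[of _ "1::real"])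
      obtain l where l: "((\<lambda>z. partial1 H' 1 z) \<longlongrightarrow> l) at_top" using H1 by blast
      with partial1_homogeneous_limit[OF H H_lim(2)] have "l = -1" by blast
      with l have "Lim at_top (\<lambda>z. partial2 H z 1) = -1" unfolding partial by (intro tendsto_Lim) auto
      then have K: "K3b H \<sigma>1 \<xi>1 \<sigma>2 \<xi>2 rF = (- \<xi>2) powr (- 1 / \<xi>2) * rF powr (- 1 / \<xi>2) * \<sigma>2 powr (1 / \<xi>2)"
        using 2 by (simp add: K3b_def)
      show "K3b H \<sigma>1 \<xi>1 \<sigma>2 \<xi>2 rF > 0"
        unfolding K using pos \<xi> \<open>rF > 0\<close> by simp
      have "(\<lambda>w. g (1 - w)) \<sim>[at_left 1]
          (\<lambda>w. w powr (- 1 / 2) * (1 - w) powr (- 1 / 2) * (1 - H' (1 / (1 - w)) (1 / w)))"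
        using asymp_equiv_reflect_unit[OF g] by (simp add: H'_def mult_ac)
      from asymp_equiv_trans[OF this homogeneous_asymp_equiv_sqrt[OF H H_lim(1) H1(2)]]
      have "(\<lambda>w. g (1 - w)) \<sim>[at_left 1] (\<lambda>w. 1 * (1 - w) powr (1 / (2 * \<eta>)))"
        by (simp add: \<eta>)
      from sum_tail(2)[OF this _ _ refl \<eta> refl]
      show "(\<lambda>r. prob {\<omega> \<in> space M. X2 \<omega> + X1 \<omega> \<ge> r}) \<sim>[at_left rF]
          (\<lambda>r. K3b H \<sigma>1 \<xi>1 \<sigma>2 \<xi>2 rF * (1 - r / rF) powr (- 1 / \<xi>2))"
        unfolding K using \<open>\<eta> > 0\<close> by simp
    qed
  qed
qed

end
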